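(* Fix $0<\kappa\le\frac12$. In the setting described in the context, consider for $A:B_{n_0}(\eta)\to\mathbb M_{n_0\times n_0}(\mathbb R)$ the equation, in polar coordinates $u=r\omega$, $$\partial_r\big(rA(r\omega)\big)=-A(r\omega)^2-C_u(r\omega)A(r\omega)-C_u(r\omega).$$ There exists an admissible constant $\eta_1=\eta_1(\kappa)>0$ such that there is a unique solution $A\in C(B_{n_0}(\eta_1);\mathbb M_{n_0\times n_0}(\mathbb R))$ satisfying $A(r\omega)=O(r)$ for each fixed $\omega$. This solution satisfies $\|A(t)\|\lesssim|t|$ and $\sup_{t\in B_{n_0}(\eta_1)}\|A(t)\|\le\kappa$. Furthermore, if $\tilde c^k_{i,j}\in C^m(B_{n_0}(\eta_1))$ with $\|\tilde c^k_{i,j}\|_{C^m(B_{n_0}(\eta_1))}\le\widetilde C_{m,\eta_1}<\infty$ for all $1\le i,j,k\le n_0$, then $A\in C^m$ and $\|A\|_{C^m(B_{n_0}(\eta_1);\mathbb M_{n_0\times n_0}(\mathbb R))}\le C_m$, where $C_m=C_m(m,\widetilde C_{m,\eta_1})$ is an admissible constant (allowed also to depend on $m$ and $\widetilde C_{m,\eta_1}$).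
   Context: Setting: $\Omega\subseteq\mathbb R^n$ connected open; $X_1,\dots,X_{n_0}$ $C^1$ vector fields on $\Omega$ with degrees $d_j\in(0,\infty)$; $\xi\in(0,1]$, $x_0\in\Omega$, $(X,d)$ satisfies $\mathcal C(x_0,\xi)$; on $B=B_{(X,d)}(x_0,\xi)$, $[X_j,X_k]=\sum_{l=1}^{n_0}c^l_{j,k}X_l$; $X_1(x_0),\dots,X_{n_0}(x_0)$ linearly independent; $\|X_j\|_{C^1(B)}<\infty$; $\sum_{|\alpha|\le2}\|X^\alpha c^l_{j,k}\|_{C^0(B)}<\infty$ (derivatives continuous). Here $B_{(X,d)}(x_0,\xi)$ is the set of $\gamma(1)$ over paths $\gamma:[0,1]\to\Omega$, $\gamma(t)=x_0+\int_0^t\sum a_j\xi^{d_j}X_j(\gamma)$, $\|(\sum|a_j|^2)^{1/2}\|_\infty<1$; $\mathcal C(x_0,\xi)$ means all such paths exist in $\Omega$. $\Phi(u)=e^{u_1X_1+\cdots+u_{n_0}X_{n_0}}x_0$ (time-one flow), defined on $B_{n_0}(\eta)$ for a sufficiently small admissible $\eta>0$. Define $\tilde c^k_{i,j}(u)=c^k_{i,j}(\Phi(u))$ and the $n_0\times n_0$ matrix $C_u$ by $(C_u)_{i,k}(u)=\sum_{j=1}^{n_0}u_j\tilde c^k_{i,j}(u)$. $\|\cdot\|$ is the operator norm. Admissible constants depend only on upper and positive lower bounds for the $d_j$, an upper bound for $n$, a positive lower bound for $\xi$, and upper bounds for $\|X_j\|_{C^1(B)}$ and $\sum_{|\alpha|\le2}\|X^\alpha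 c^l_{j,k}\|_{C^0(B)}$; $\lesssim$ is up to admissible constants. $\|f\|_{C^m(U)}=\sup_U\sum_{|\beta|\le m}|\partial^\beta f|$. *)

theory Defs
  imports "HOL-Analysis.Analysis"
begin

text \<open>Vector fields X j (j ranging over the finite index type 'k, so n0 = CARD('k))
on Omega, a subset of real^'n.  A control is a measurable a : [0,1] -> R^n0 with
sup-norm of the Euclidean norm strictly less than 1.\<close>

definition adm_ctrl :: "(real \<Rightarrow> real^'k) \<Rightarrow> bool" where
  "adm_ctrl a \<longleftrightarrow> a measurable_on {0..1} \<and> (\<exists>c<1. \<forall>t\<in>{0..1}. norm (a t) \<le> c)"

definition ctrl_path ::
  "(real^'n) set \<Rightarrow> ('k::finite \<Rightarrow> real^'n \<Rightarrow> real^'n) \<Rightarrow> ('k \<Rightarrow> real) \<Rightarrow> real \<Rightarrow> real^'n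
   \<Rightarrow> (real \<Rightarrow> real^'k) \<Rightarrow> (real \<Rightarrow> real^'n) \<Rightarrow> bool" where
  "ctrl_path \<Omega> X d \<xi> x0 a \<gamma> \<longleftrightarrow> \<gamma> ` {0..1} \<subseteq> \<Omega> \<and>
     (\<forall>t\<in>{0..1}. ((\<lambda>s. \<Sum>j\<in>UNIV. (a s $ j * \<xi> powr d j) *\<^sub>R X j (\<gamma> s))
                    has_integral (\<gamma> t - x0)) {0..t})"

definition ballXd ::
  "(real^'n) set \<Rightarrow> ('k::finite \<Rightarrow> real^'n \<Rightarrow> real^'n) \<Rightarrow> ('k \<Rightarrow> real) \<Rightarrow> real \<Rightarrow> real^'n
   \<Rightarrow> (real^'n) set" where
  "ballXd \<Omega> X d \<xi> x0 = {\<gamma> 1 | \<gamma> a. adm_ctrl a \<and> ctrl_path \<Omega> X d \<xi> x0 a \<gamma>}"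

definition condC ::
  "(real^'n) set \<Rightarrow> ('k::finite \<Rightarrow> real^'n \<Rightarrow> real^'n) \<Rightarrow> ('k \<Rightarrow> real) \<Rightarrow> real \<Rightarrow> real^'n \<Rightarrow> bool" where
  "condC \<Omega> X d \<xi> x0 \<longleftrightarrow> (\<forall>a. adm_ctrl a \<longrightarrow> (\<exists>\<gamma>. ctrl_path \<Omega> X d \<xi> x0 a \<gamma>))"

definition has_lie_deriv ::
  "(real^'n \<Rightarrow> real^'n) \<Rightarrow> (real^'n \<Rightarrow> real) \<Rightarrow> (real^'n) set \<Rightarrow> real^'n \<Rightarrow> real \<Rightarrow> bool" where
  "has_lie_deriv V f S x L \<longleftrightarrow>
     (\<exists>e>0. \<exists>\<gamma>. \<gamma> 0 = x \<and>
        (\<forall>t\<in>{-e<..<e}. \<gamma> t \<in> S \<and> (\<gamma> has_vector_derivative V (\<gamma> t)) (at t)) \<and>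
        ((\<lambda>t. f (\<gamma> t)) has_real_derivative L) (at 0))"

definition lie_deriv ::
  "(real^'n \<Rightarrow> real^'n) \<Rightarrow> (real^'n \<Rightarrow> real) \<Rightarrow> (real^'n) set \<Rightarrow> real^'n \<Rightarrow> real" where
  "lie_deriv V f S x = (THE L. has_lie_deriv V f S x L)"

definition Phi ::
  "(real^'n) set \<Rightarrow> ('k::finite \<Rightarrow> real^'n \<Rightarrow> real^'n) \<Rightarrow> real^'n \<Rightarrow> real^'k \<Rightarrow> real^'n" where
  "Phi \<Omega> X x0 u = (THE y. \<exists>\<gamma>. \<gamma> 0 = x0 \<and> \<gamma> 1 = y \<and> \<gamma> ` {0..1} \<subseteq> \<Omega> \<and>
      (\<forall>t\<in>{0..1}. (\<gamma> has_vector_derivative (\<Sum>j\<in>UNIV. u $ j *\<^sub>R X j (\<gamma> t))) (at t within {0..1})))"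

text \<open>c i j k x stands for c^k_{i,j}(x).  ctilde i j k u = c^k_{i,j}(Phi u).\<close>

definition ctilde ::
  "(real^'n) set \<Rightarrow> ('k::finite \<Rightarrow> real^'n \<Rightarrow> real^'n) \<Rightarrow> real^'n
   \<Rightarrow> ('k \<Rightarrow> 'k \<Rightarrow> 'k \<Rightarrow> real^'n \<Rightarrow> real) \<Rightarrow> 'k \<Rightarrow> 'k \<Rightarrow> 'k \<Rightarrow> real^'k \<Rightarrow> real" where
  "ctilde \<Omega> X x0 c i j k u = c i j k (Phi \<Omega> X x0 u)"

definition Cmat ::
  "(real^'n) set \<Rightarrow> ('k::finite \<Rightarrow> real^'n \<Rightarrow> real^'n) \<Rightarrow> real^'n
   \<Rightarrow> ('k \<Rightarrow> 'k \<Rightarrow> 'k \<Rightarrow> real^'n \<Rightarrow> real) \<Rightarrow> real^'k \<Rightarrow> real^'k^'k" where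
  "Cmat \<Omega> X x0 c u = (\<chi> i k. \<Sum>j\<in>UNIV. u $ j * ctilde \<Omega> X x0 c i j k u)"

definition opnorm :: "real^'k^'k \<Rightarrow> real" where
  "opnorm M = onorm (\<lambda>v. M *v v)"

definition setting ::
  "(real^'n) set \<Rightarrow> ('k::finite \<Rightarrow> real^'n \<Rightarrow> real^'n) \<Rightarrow> ('k \<Rightarrow> real) \<Rightarrow> real \<Rightarrow> real^'n
   \<Rightarrow> ('k \<Rightarrow> 'k \<Rightarrow> 'k \<Rightarrow> real^'n \<Rightarrow> real)
   \<Rightarrow> real \<Rightarrow> real \<Rightarrow> real \<Rightarrow> real \<Rightarrow> real \<Rightarrow> bool" where
  "setting \<Omega> X d \<xi> x0 c dmin dmax ximin CX Cc \<longleftrightarrow>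
     open \<Omega> \<and> connected \<Omega> \<and>
     \<comment> \<open>C^1 vector fields on Omega\<close>
     (\<forall>j. (\<forall>x\<in>\<Omega>. X j differentiable (at x)) \<and>
          continuous_on \<Omega> (\<lambda>x. frechet_derivative (X j) (at x))) \<and>
     \<comment> \<open>degrees with upper and positive lower bounds\<close>
     (\<forall>j. dmin \<le> d j \<and> d j \<le> dmax) \<and>
     ximin \<le> \<xi> \<and> 0 < \<xi> \<and> \<xi> \<le> 1 \<and>
     x0 \<in> \<Omega> \<and> condC \<Omega> X d \<xi> x0 \<and>
     (let B = ballXd \<Omega> X d \<xi> x0 in
       \<comment> \<open>commutator relations [X_j,X_k] = sum_l c^l_{j,k} X_l on B\<close>
       (\<forall>x\<in>B. \<forall>j k. frechet_derivative (X k) (at x) (X j x) - frechet_derivative (X j) (at x) (X k x)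
                     = (\<Sum>l\<in>UNIV. c j k l x *\<^sub>R X l x)) \<and>
       \<comment> \<open>linear independence of X_1(x0),...,X_n0(x0)\<close>
       (\<forall>a::real^'k. (\<Sum>j\<in>UNIV. a $ j *\<^sub>R X j x0) = 0 \<longrightarrow> a = 0) \<and>
       \<comment> \<open>C^1(B) bounds for X_j\<close>
       (\<forall>j. \<forall>x\<in>B. norm (X j x) \<le> CX \<and> onorm (frechet_derivative (X j) (at x)) \<le> CX) \<and>
       \<comment> \<open>X^alpha c^l_{j,k} exist, are continuous on B and bounded, |alpha| <= 2\<close>
       (\<forall>j k l. continuous_on B (c j k l) \<and> (\<forall>x\<in>B. \<bar>c j k l x\<bar> \<le> Cc) \<and>
          (\<forall>i. (\<forall>x\<in>B. \<exists>L. has_lie_deriv (X i) (c j k l) B x L) \<and>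
               continuous_on B (lie_deriv (X i) (c j k l) B) \<and>
               (\<forall>x\<in>B. \<bar>lie_deriv (X i) (c j k l) B x\<bar> \<le> Cc)) \<and>
          (\<forall>i i'. (\<forall>x\<in>B. \<exists>L. has_lie_deriv (X i) (lie_deriv (X i') (c j k l) B) B x L) \<and>
               continuous_on B (lie_deriv (X i) (lie_deriv (X i') (c j k l) B) B) \<and>
               (\<forall>x\<in>B. \<bar>lie_deriv (X i) (lie_deriv (X i') (c j k l) B) B x\<bar> \<le> Cc))))"

definition is_sol ::
  "real \<Rightarrow> (real^'n) set \<Rightarrow> ('k::finite \<Rightarrow> real^'n \<Rightarrow> real^'n) \<Rightarrow> real^'n
   \<Rightarrow> ('k \<Rightarrow> 'k \<Rightarrow> 'k \<Rightarrow> real^'n \<Rightarrow> real) \<Rightarrow> (real^'k \<Rightarrow> real^'k^'k) \<Rightarrow> bool" where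
  "is_sol \<eta> \<Omega> X x0 c A \<longleftrightarrow>
     continuous_on (ball 0 \<eta>) A \<and>
     (\<forall>\<omega>::real^'k. norm \<omega> = 1 \<longrightarrow>
        (\<forall>r\<in>{0<..<\<eta>}.
           ((\<lambda>s. s *\<^sub>R A (s *\<^sub>R \<omega>)) has_vector_derivative
              (- (A (r *\<^sub>R \<omega>) ** A (r *\<^sub>R \<omega>)) - Cmat \<Omega> X x0 c (r *\<^sub>R \<omega>) ** A (r *\<^sub>R \<omega>)
               - Cmat \<Omega> X x0 c (r *\<^sub>R \<omega>))) (at r)) \<and>
        (\<exists>K \<delta>. \<delta> > 0 \<and> (\<forall>r\<in>{0<..<\<delta>}. opnorm (A (r *\<^sub>R \<omega>)) \<le> K * r)))"

fun pderivs :: "'k::finite list \<Rightarrow> (real^'k \<Rightarrow> real) \<Rightarrow> real^'k \<Rightarrow> real" where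
  "pderivs [] f = f"
| "pderivs (i # is) f = (\<lambda>x. deriv (\<lambda>t. pderivs is f (x + t *\<^sub>R axis i 1)) 0)"

definition is_Cm :: "nat \<Rightarrow> (real^'k::finite \<Rightarrow> real) \<Rightarrow> (real^'k) set \<Rightarrow> bool" where
  "is_Cm m f U \<longleftrightarrow>
     (\<forall>\<beta>. length \<beta> \<le> m \<longrightarrow> continuous_on U (pderivs \<beta> f)) \<and>
     (\<forall>\<beta>. length \<beta> < m \<longrightarrow>
        (\<forall>x\<in>U. \<forall>i. (\<lambda>t. pderivs \<beta> f (x + t *\<^sub>R axis i 1)) differentiable (at 0)))"

definition Cm_norm_le :: "nat \<Rightarrow> (real^'k::finite \<Rightarrow> real) \<Rightarrow> (real^'k) set \<Rightarrow> real \<Rightarrow> bool" where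
  "Cm_norm_le m f U C \<longleftrightarrow> (\<forall>x\<in>U. (\<Sum>\<beta>\<in>{\<beta>. length \<beta> \<le> m}. \<bar>pderivs \<beta> f x\<bar>) \<le> C)"

definition Cm_norm_le_mat :: "nat \<Rightarrow> (real^'k::finite \<Rightarrow> real^'k^'k) \<Rightarrow> (real^'k) set \<Rightarrow> real \<Rightarrow> bool" where
  "Cm_norm_le_mat m A U C \<longleftrightarrow>
     (\<forall>x\<in>U. (\<Sum>\<beta>\<in>{\<beta>. length \<beta> \<le> m}. \<Sum>i\<in>UNIV. \<Sum>j\<in>UNIV. \<bar>pderivs \<beta> (\<lambda>u. A u $ i $ j) x\<bar>) \<le> C)"

end

theory Submission
  imports Defs
begin

text \<open>In integrated form the equation reads \<open>A u = - \<integral>\<^sub>0\<^sup>1 (A\<^sup>2 + C A + C) (s u) ds\<close>. As \<open>C u = O(|u|)\<close>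
  with an admissible constant, the right hand side contracts on small matrix-valued functions on a small
  ball. Uniqueness follows from Gronwall's inequality along rays, and continuity of \<open>C\<close> from continuous
  dependence of the flow on its parameters.

  For regularity, a partial derivative of \<open>A\<close> formally solves the \<^emph>\<open>linear\<close> equation of the same kind,
  with weight \<open>s\<close> instead of \<open>1\<close> and coefficients built from \<open>A\<close>, \<open>C\<close> and the derivative of \<open>C\<close>; the
  difference quotients of \<open>A\<close> solve it up to a vanishing error, which the contraction absorbs. The
  contraction constant is that of the linearisation, so the same ball works for every order. Hence
  the induction on \<open>m\<close> runs over quadratic equations with arbitrary weights \<open>s\<^sup>p\<close>, linear ones included.\<close>

section \<open>Fixed points of contractions\<close>

lemma uniformly_Cauchy_on_geometric:
  fixes F :: "nat \<Rightarrow> 'a \<Rightarrow> 'b::metric_space"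
  assumes dist_F: "\<And>n k u. u \<in> U \<Longrightarrow> dist (F (n + k) u) (F n u) \<le> B * q ^ n" and q: "0 \<le> q" "q < 1"
  shows "uniformly_Cauchy_on U F"
proof (rule uniformly_Cauchy_onI')
  fix \<epsilon> :: real assume "\<epsilon> > 0"
  moreover have "(\<lambda>n. B * q ^ n) \<longlonglongrightarrow> B * 0"
    using q by (intro tendsto_intros LIMSEQ_realpow_zero)
  ultimately obtain N where N: "\<And>n. n \<ge> N \<Longrightarrow> B * q ^ n < \<epsilon>"
    using order_tendstoD(2)[of _ "B * 0" sequentially \<epsilon>] by (auto simp: eventually_sequentially)
  show "\<exists>M. \<forall>u\<in>U. \<forall>m\<ge>M. \<forall>n>m. dist (F m u) (F n u) < \<epsilon>"
  proof (intro exI[of _ N] ballI allI impI)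
    fix u m n assume "u \<in> U" "m \<ge> N" "n > m"
    then show "dist (F m u) (F n u) < \<epsilon>"
      using dist_F[of u m "n - m"] N[of m] by (simp add: dist_commute)
  qed
qed

lemma uniform_limit_eq_of_close_successors:
  fixes F :: "nat \<Rightarrow> 'a \<Rightarrow> 'b::metric_space"
  assumes lim: "uniform_limit U F f sequentially" and q: "q < 1" and u: "u \<in> U"
    and close: "\<And>n \<epsilon>. (\<And>v. v \<in> U \<Longrightarrow> dist (F n v) (f v) \<le> \<epsilon>) \<Longrightarrow> dist (F (Suc n) u) (g u) \<le> q * \<epsilon>"
  shows "g u = f u"
proof (rule LIMSEQ_unique)
  show "(\<lambda>n. F (Suc n) u) \<longlonglongrightarrow> f u" by (rule LIMSEQ_Suc[OF tendsto_uniform_limitI[OF lim u]])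
  show "(\<lambda>n. F (Suc n) u) \<longlonglongrightarrow> g u"
  proof (rule tendstoI)
    fix \<epsilon> :: real assume \<epsilon>: "\<epsilon> > 0"
    show "\<forall>\<^sub>F n in sequentially. dist (F (Suc n) u) (g u) < \<epsilon>"
      using uniform_limitD[OF lim \<epsilon>]
    proof eventually_elim
      case (elim n)
      then have "dist (F (Suc n) u) (g u) \<le> q * \<epsilon>" by (intro close) (simp add: less_imp_le)
      also have "\<dots> < \<epsilon>" using q \<epsilon> by simp
      finally show ?case .
    qed
  qed
qed

lemma contraction_fixpoint_continuous_on:
  fixes T :: "('a::topological_space \<Rightarrow> 'b::complete_space) \<Rightarrow> 'a \<Rightarrow> 'b"
  assumes S: "closed S" "bounded S" "S \<noteq> {}" and q: "0 \<le> q" "q < 1"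
    and maps: "\<And>f. continuous_on U f \<Longrightarrow> f ` U \<subseteq> S \<Longrightarrow> continuous_on U (T f) \<and> T f ` U \<subseteq> S"
    and contracts: "\<And>f g \<epsilon> u. continuous_on U f \<Longrightarrow> f ` U \<subseteq> S \<Longrightarrow> continuous_on U g \<Longrightarrow> g ` U \<subseteq> S \<Longrightarrow>
      (\<And>v. v \<in> U \<Longrightarrow> dist (f v) (g v) \<le> \<epsilon>) \<Longrightarrow> u \<in> U \<Longrightarrow> dist (T f u) (T g u) \<le> q * \<epsilon>"
  obtains f where "continuous_on U f" "f ` U \<subseteq> S" "\<And>u. u \<in> U \<Longrightarrow> T f u = f u"
proof -
  obtain x0 where x0: "x0 \<in> S" using S(3) by blast
  define F where "F n = (T ^^ n) (\<lambda>u. x0)" for n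
  have F_Suc: "F (Suc n) = T (F n)" for n by (simp add: F_def)
  have "continuous_on U (F n) \<and> F n ` U \<subseteq> S" for n
    by (induction n) (use x0 maps in \<open>auto simp: F_def\<close>)
  then have F_cont: "continuous_on U (F n)" and F_in: "F n ` U \<subseteq> S" for n by auto
  obtain B where B: "\<And>x y. x \<in> S \<Longrightarrow> y \<in> S \<Longrightarrow> dist x y \<le> B"
    using S(2) unfolding bounded_two_points by blast
  have "dist (F (n + k) u) (F n u) \<le> B * q ^ n" if "u \<in> U" for n k u
    using that
  proof (induction n arbitrary: u)
    case 0
    then show ?case using F_in by (auto intro!: B)
  next
    case (Suc n)
    have "dist (T (F (n + k)) u) (T (F n) u) \<le> q * (B * q ^ n)"
      by (rule contracts[OF F_cont F_in F_cont F_in Suc.IH Suc.prems])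
    then show ?case by (simp add: F_Suc mult_ac)
  qed
  then have "uniformly_Cauchy_on U F" by (rule uniformly_Cauchy_on_geometric[OF _ q])
  then obtain f where lim: "uniform_limit U F f sequentially"
    using Cauchy_uniformly_convergent uniformly_convergent_on_def by blast
  have f_cont: "continuous_on U f"
    by (rule uniform_limit_theorem[OF _ lim]) (simp_all add: F_cont)
  have f_in: "f ` U \<subseteq> S"
    using closed_sequentially[OF S(1) _ tendsto_uniform_limitI[OF lim]] F_in by blast
  have "T f u = f u" if u: "u \<in> U" for u
  proof (rule uniform_limit_eq_of_close_successors[OF lim q(2) u])
    show "dist (F (Suc n) u) (T f u) \<le> q * \<epsilon>" if "\<And>v. v \<in> U \<Longrightarrow> dist (F n v) (f v) \<le> \<epsilon>" for n \<epsilon>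
      unfolding F_Suc by (rule contracts[OF F_cont F_in f_cont f_in that u])
  qed
  then show thesis using that f_cont f_in by blast
qed

section \<open>Averages along rays\<close>

definition star_at_0 :: "'a::real_vector set \<Rightarrow> bool" where
  "star_at_0 U \<longleftrightarrow> 0 \<in> U \<and> (\<forall>u\<in>U. \<forall>s\<in>{0..1}. s *\<^sub>R u \<in> U)"

lemma star_at_0D: "star_at_0 U \<Longrightarrow> u \<in> U \<Longrightarrow> s \<in> {0..1} \<Longrightarrow> s *\<^sub>R u \<in> U"
  by (simp add: star_at_0_def)

lemma star_at_0_ball: "0 < r \<Longrightarrow> star_at_0 (ball (0::'a::real_normed_vector) r)"
  unfolding star_at_0_def
  by (auto intro: le_less_trans[OF mult_left_le_one_le[OF norm_ge_zero]])

lemma continuous_on_ray: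
  fixes U :: "'a::real_normed_vector set"
  assumes "star_at_0 U" "continuous_on U f" "u \<in> U"
  shows "continuous_on {0..1} (\<lambda>s. f (s *\<^sub>R u))"
  by (rule continuous_on_compose2[OF assms(2)])
     (use assms(1,3) in \<open>auto intro!: continuous_intros simp: star_at_0D\<close>)

definition ray_avg :: "nat \<Rightarrow> ('a::real_normed_vector \<Rightarrow> 'b::banach) \<Rightarrow> 'a \<Rightarrow> 'b" where
  "ray_avg p f u = integral {0..1} (\<lambda>s. s ^ p *\<^sub>R f (s *\<^sub>R u))"

lemma ray_avg_scaleR_arg: "ray_avg p f (s *\<^sub>R u) = ray_avg p (\<lambda>\<sigma>. f (\<sigma> *\<^sub>R u)) s"
  by (simp add: ray_avg_def mult.commute)

lemma scaleR_ray_avg_Suc: "s *\<^sub>R ray_avg (Suc p) f (s *\<^sub>R u) = ray_avg p (\<lambda>\<sigma>. \<sigma> *\<^sub>R f (\<sigma> *\<^sub>R u)) s"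
  by (simp add: ray_avg_def mult_ac flip: integral_cmul)

lemma has_integral_ray_avg:
  assumes "continuous_on {0..1} (\<lambda>s. f (s *\<^sub>R u))"
  shows "((\<lambda>s. s ^ p *\<^sub>R f (s *\<^sub>R u)) has_integral ray_avg p f u) {0..1}"
  unfolding ray_avg_def
  by (intro integrable_integral integrable_continuous_real continuous_intros assms)

lemma ray_avg_diff:
  assumes "continuous_on {0..1} (\<lambda>s. f (s *\<^sub>R u))" "continuous_on {0..1} (\<lambda>s. g (s *\<^sub>R u))"
  shows "ray_avg p (\<lambda>v. f v - g v) u = ray_avg p f u - ray_avg p g u"
  using has_integral_diff[OF has_integral_ray_avg[OF assms(1)] has_integral_ray_avg[OF assms(2)], of p p]
  by (simp add: ray_avg_def integral_unique scaleR_diff_right)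

lemma ray_avg_scaleR: "ray_avg p (\<lambda>v. a *\<^sub>R f v) u = a *\<^sub>R ray_avg p f u"
  by (simp add: ray_avg_def mult.commute[of _ a] flip: integral_cmul)

lemma norm_ray_avg_le:
  assumes cont: "continuous_on {0..1} (\<lambda>s. f (s *\<^sub>R u))"
    and bound: "\<And>s. s \<in> {0..1} \<Longrightarrow> norm (f (s *\<^sub>R u)) \<le> M"
  shows "norm (ray_avg p f u) \<le> M"
proof -
  have "0 \<le> M" using order_trans[OF norm_ge_zero bound[of 0]] by simp
  have integrand_le: "norm (s ^ p *\<^sub>R f (s *\<^sub>R u)) \<le> M" if "s \<in> cbox 0 1" for s
    using that \<open>0 \<le> M\<close> bound[of s] mult_mono[of "s ^ p" 1 "norm (f (s *\<^sub>R u))" M]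
    by (simp add: power_le_one)
  have "((\<lambda>s. s ^ p *\<^sub>R f (s *\<^sub>R u)) has_integral ray_avg p f u) (cbox 0 1)"
    using has_integral_ray_avg[OF cont] by simp
  from has_integral_bound[OF \<open>0 \<le> M\<close> this integrand_le] show ?thesis by simp
qed

lemma continuous_on_ray_avg:
  assumes "star_at_0 U" "continuous_on U f"
  shows "continuous_on U (ray_avg p f)"
proof -
  have "continuous_on (U \<times> cbox 0 1) (\<lambda>(u, s). s ^ p *\<^sub>R f (s *\<^sub>R u))"
    unfolding split_beta
    by (intro continuous_intros continuous_on_compose2[OF assms(2)])
       (use star_at_0D[OF assms(1)] in auto)
  from integral_continuous_on_param[OF this] show ?thesis
    by (simp add: ray_avg_def[abs_def])
qed

text \<open>The bound absorbs itself: if \<open>m\<close> is the maximum of \<open>norm \<circ> f\<close> on the segment from \<open>0\<close>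
  to \<open>u\<close>, then \<open>m \<le> q * m + h\<close>.\<close>

lemma ray_avg_absorption:
  assumes f: "continuous_on {0..1} (\<lambda>s. f (s *\<^sub>R u))" and g: "continuous_on {0..1} (\<lambda>s. g (s *\<^sub>R u))"
    and eq: "\<And>s. s \<in> {0..1} \<Longrightarrow> f (s *\<^sub>R u) = ray_avg p g (s *\<^sub>R u)"
    and bound: "\<And>s. s \<in> {0..1} \<Longrightarrow> norm (g (s *\<^sub>R u)) \<le> q * norm (f (s *\<^sub>R u)) + h"
    and q: "0 \<le> q" "q < 1"
  shows "norm (f u) \<le> h / (1 - q)"
proof -
  have "continuous_on {0..1} (\<lambda>s. norm (f (s *\<^sub>R u)))" by (intro continuous_on_norm f)
  then obtain s0 where s0: "s0 \<in> {0..1}"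
    and max: "\<And>s. s \<in> {0..1} \<Longrightarrow> norm (f (s *\<^sub>R u)) \<le> norm (f (s0 *\<^sub>R u))"
    using continuous_attains_sup[OF compact_Icc, of 0 "1::real"]
    by (metis atLeastAtMost_iff empty_iff order_refl zero_le_one)
  define m where "m = norm (f (s0 *\<^sub>R u))"
  have in01: "s * s0 \<in> {0..1}" if "s \<in> {0..1}" for s using s0 that by (auto intro: mult_le_one)
  have "norm (ray_avg p g (s0 *\<^sub>R u)) \<le> q * m + h"
  proof (rule norm_ray_avg_le)
    show "continuous_on {0..1} (\<lambda>s. g (s *\<^sub>R s0 *\<^sub>R u))"
      unfolding scaleR_scaleR
      by (rule continuous_on_compose2[OF g]) (use in01 in \<open>auto intro!: continuous_intros\<close>)
    show "norm (g (s *\<^sub>R s0 *\<^sub>R u)) \<le> q * m + h" if "s \<in> {0..1}" for s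
      using bound[OF in01[OF that]] mult_left_mono[OF max[OF in01[OF that]] q(1)]
      by (simp add: m_def)
  qed
  then have "m \<le> q * m + h" using eq[OF s0] by (simp add: m_def)
  then have "m \<le> h / (1 - q)" using q(2) by (simp add: pos_le_divide_eq algebra_simps)
  then show ?thesis using max[of 1] by (simp add: m_def)
qed

lemma ray_avg_difference_quotient:
  assumes U: "star_at_0 U" "u \<in> U" "w \<in> U" and cont: "continuous_on U f" "continuous_on U g"
    and s: "s \<in> {0..1}"
  shows "ray_avg p (\<lambda>\<sigma>. (f (\<sigma> *\<^sub>R w) - f (\<sigma> *\<^sub>R u)) /\<^sub>R t - \<sigma> *\<^sub>R g (\<sigma> *\<^sub>R u)) s
    = (ray_avg p f (s *\<^sub>R w) - ray_avg p f (s *\<^sub>R u)) /\<^sub>R t - s *\<^sub>R ray_avg (Suc p) g (s *\<^sub>R u)"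
proof -
  have ray: "continuous_on {0..1} (\<lambda>\<sigma>. h ((\<sigma> *\<^sub>R s) *\<^sub>R v))" if "continuous_on U h" "v \<in> U" for v h
    using continuous_on_ray[OF U(1) that(1) star_at_0D[OF U(1) that(2) s]] by simp
  note rays = continuous_intros ray cont U(2,3)
  have "ray_avg p (\<lambda>\<sigma>. (f (\<sigma> *\<^sub>R w) - f (\<sigma> *\<^sub>R u)) /\<^sub>R t - \<sigma> *\<^sub>R g (\<sigma> *\<^sub>R u)) s
    = ray_avg p (\<lambda>\<sigma>. f (\<sigma> *\<^sub>R w) - f (\<sigma> *\<^sub>R u)) s /\<^sub>R t - ray_avg p (\<lambda>\<sigma>. \<sigma> *\<^sub>R g (\<sigma> *\<^sub>R u)) s"
    unfolding ray_avg_scaleR[symmetric] by (intro ray_avg_diff rays)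
  also have "ray_avg p (\<lambda>\<sigma>. f (\<sigma> *\<^sub>R w) - f (\<sigma> *\<^sub>R u)) s
    = ray_avg p (\<lambda>\<sigma>. f (\<sigma> *\<^sub>R w)) s - ray_avg p (\<lambda>\<sigma>. f (\<sigma> *\<^sub>R u)) s"
    by (intro ray_avg_diff rays)
  finally show ?thesis unfolding ray_avg_scaleR_arg[of p] scaleR_ray_avg_Suc .
qed

lemma scaleR_ray_avg_0:
  assumes "continuous_on {0..1} (\<lambda>s. f (s *\<^sub>R r *\<^sub>R \<omega>))" and r: "0 < r"
  shows "r *\<^sub>R ray_avg 0 f (r *\<^sub>R \<omega>) = integral {0..r} (\<lambda>s. f (s *\<^sub>R \<omega>))"
proof -
  have "((\<lambda>s. f ((r * s) *\<^sub>R \<omega>)) has_integral ray_avg 0 f (r *\<^sub>R \<omega>)) {0..1}"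
    using has_integral_ray_avg[OF assms(1), of 0] by (simp add: mult.commute)
  moreover have "(\<lambda>s. s / r) ` {0..r} = {0..1}"
    using r image_divide_atLeastAtMost[of r 0 r] by simp
  ultimately show ?thesis
    using has_integral_stretch_real_iff[of r "\<lambda>s. f (s *\<^sub>R \<omega>)" _ 0 r] r
    by (auto intro: integral_unique[symmetric])
qed

lemma ray_avg_radial_derivative:
  assumes U: "star_at_0 U" and f: "continuous_on U f" and r: "0 < r" "r < T" and T: "T *\<^sub>R \<omega> \<in> U"
  shows "((\<lambda>s. s *\<^sub>R ray_avg 0 f (s *\<^sub>R \<omega>)) has_vector_derivative f (r *\<^sub>R \<omega>)) (at r)"
proof -
  have inU: "s *\<^sub>R \<omega> \<in> U" if "s \<in> {0..T}" for s
    using star_at_0D[OF U T, of "s / T"] r that by (simp add: divide_le_eq)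
  have "continuous_on {0..T} (\<lambda>s. f (s *\<^sub>R \<omega>))"
    by (rule continuous_on_compose2[OF f]) (use inU in \<open>auto intro!: continuous_intros\<close>)
  from integral_has_vector_derivative[OF this, of r]
  have "((\<lambda>s. integral {0..s} (\<lambda>\<sigma>. f (\<sigma> *\<^sub>R \<omega>))) has_vector_derivative f (r *\<^sub>R \<omega>)) (at r)"
    using r at_within_interior[of r "{0..T}"] by simp
  then show ?thesis
  proof (rule has_vector_derivative_transform_within_open[of _ _ _ "{0<..<T}"])
    show "integral {0..s} (\<lambda>\<sigma>. f (\<sigma> *\<^sub>R \<omega>)) = s *\<^sub>R ray_avg 0 f (s *\<^sub>R \<omega>)" if "s \<in> {0<..<T}" for s
      using that by (intro scaleR_ray_avg_0[symmetric] continuous_on_ray[OF U f] inU) auto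
  qed (use r in auto)
qed

section \<open>Directional derivatives\<close>

definition has_dir_deriv ::
  "'a::real_normed_vector \<Rightarrow> ('a \<Rightarrow> 'b::real_normed_vector) \<Rightarrow> ('a \<Rightarrow> 'b) \<Rightarrow> 'a set \<Rightarrow> bool" where
  "has_dir_deriv e f D U \<longleftrightarrow> (\<forall>u\<in>U. ((\<lambda>t. f (u + t *\<^sub>R e)) has_vector_derivative D u) (at 0))"

lemma has_vector_derivative_at_0_iff:
  fixes f :: "real \<Rightarrow> 'a::real_normed_vector"
  shows "(f has_vector_derivative D) (at 0) \<longleftrightarrow> ((\<lambda>t. (f t - f 0) /\<^sub>R t) \<longlongrightarrow> D) (at 0)"
proof -
  have "(f has_vector_derivative D) (at 0) \<longleftrightarrow> ((\<lambda>t. norm (f t - f 0 - t *\<^sub>R D) / norm t) \<longlongrightarrow> 0) (at 0)"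
    by (simp add: has_vector_derivative_def has_derivative_at bounded_linear_scaleR_left)
  also have "\<dots> \<longleftrightarrow> ((\<lambda>t. norm ((f t - f 0) /\<^sub>R t - D)) \<longlongrightarrow> 0) (at 0)"
  proof (rule filterlim_cong[OF refl refl])
    have "norm (f t - f 0 - t *\<^sub>R D) / norm t = norm ((f t - f 0) /\<^sub>R t - D)" if "t \<noteq> 0" for t
    proof -
      have "(f t - f 0) /\<^sub>R t - D = (f t - f 0 - t *\<^sub>R D) /\<^sub>R t"
        using that by (simp add: scaleR_diff_right)
      then show ?thesis by (simp add: divide_inverse)
    qed
    then show "\<forall>\<^sub>F t in at 0. norm (f t - f 0 - t *\<^sub>R D) / norm t = norm ((f t - f 0) /\<^sub>R t - D)"
      by (simp add: eventually_at_filter)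
  qed
  finally show ?thesis by (simp add: tendsto_norm_zero_iff LIM_zero_iff)
qed

lemma has_dir_deriv_scaled_line:
  assumes "has_dir_deriv e f D U" "s *\<^sub>R (u + \<tau> *\<^sub>R e) \<in> U"
  shows "((\<lambda>\<tau>. f (s *\<^sub>R (u + \<tau> *\<^sub>R e))) has_vector_derivative s *\<^sub>R D (s *\<^sub>R (u + \<tau> *\<^sub>R e))) (at \<tau>)"
proof -
  let ?v = "s *\<^sub>R (u + \<tau> *\<^sub>R e)"
  have "((\<lambda>t. f (?v + t *\<^sub>R e)) has_vector_derivative D ?v) (at (s * (\<tau> - \<tau>)))"
    using assms by (simp add: has_dir_deriv_def)
  moreover have "((\<lambda>t. s * (t - \<tau>)) has_vector_derivative s) (at \<tau>)"
    by (auto intro!: derivative_eq_intros)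
  ultimately show ?thesis
    using vector_diff_chain_at[of "\<lambda>t. s * (t - \<tau>)" s \<tau> "\<lambda>t. f (?v + t *\<^sub>R e)" "D ?v"]
    by (simp add: o_def algebra_simps)
qed

lemma open_line_nbhd:
  fixes U :: "'a::real_normed_vector set"
  assumes "open U" "u \<in> U"
  obtains \<delta> :: real where "\<delta> > 0" "\<And>t. \<bar>t\<bar> < \<delta> \<Longrightarrow> u + t *\<^sub>R e \<in> U"
proof -
  have "open ((\<lambda>t. u + t *\<^sub>R e) -` U)"
    by (intro open_vimage assms continuous_intros)
  then obtain \<delta> where "\<delta> > 0" "ball 0 \<delta> \<subseteq> (\<lambda>t. u + t *\<^sub>R e) -` U"
    using assms(2) by (force simp: open_contains_ball)
  then show ?thesis by (intro that[of \<delta>]) auto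
qed

lemma has_dir_deriv_add:
  assumes "has_dir_deriv e f D U" "has_dir_deriv e g E U"
  shows "has_dir_deriv e (\<lambda>u. f u + g u) (\<lambda>u. D u + E u) U"
  using assms unfolding has_dir_deriv_def by (auto intro: has_vector_derivative_add)

lemma has_dir_deriv_linear:
  assumes "bounded_linear T" "has_dir_deriv e f D U"
  shows "has_dir_deriv e (\<lambda>u. T (f u)) (\<lambda>u. T (D u)) U"
  using assms unfolding has_dir_deriv_def by (auto intro: bounded_linear.has_vector_derivative)

lemma has_dir_deriv_bilinear:
  assumes "bounded_bilinear b" "has_dir_deriv e f D U" "has_dir_deriv e g E U"
  shows "has_dir_deriv e (\<lambda>u. b (f u) (g u)) (\<lambda>u. b (f u) (E u) + b (D u) (g u)) U"
  unfolding has_dir_deriv_def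
proof
  fix u assume "u \<in> U"
  then have "((\<lambda>t. f (u + t *\<^sub>R e)) has_vector_derivative D u) (at 0)"
    and "((\<lambda>t. g (u + t *\<^sub>R e)) has_vector_derivative E u) (at 0)"
    using assms(2,3) by (auto simp: has_dir_deriv_def)
  from bounded_bilinear.has_vector_derivative[OF assms(1) this]
  show "((\<lambda>t. b (f (u + t *\<^sub>R e)) (g (u + t *\<^sub>R e))) has_vector_derivative
      b (f u) (E u) + b (D u) (g u)) (at 0)"
    by simp
qed

lemma has_dir_deriv_cong:
  assumes "open U" "has_dir_deriv e f D U" "\<And>u. u \<in> U \<Longrightarrow> f u = g u"
  shows "has_dir_deriv e g D U"
  unfolding has_dir_deriv_def
proof
  fix u assume u: "u \<in> U"
  then obtain \<delta> where \<delta>: "\<delta> > 0" "\<And>t. \<bar>t\<bar> < \<delta> \<Longrightarrow> u + t *\<^sub>R e \<in> U"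
    using open_line_nbhd[OF assms(1)] by metis
  have "((\<lambda>t. f (u + t *\<^sub>R e)) has_vector_derivative D u) (at 0)"
    using assms(2) u by (simp add: has_dir_deriv_def)
  then show "((\<lambda>t. g (u + t *\<^sub>R e)) has_vector_derivative D u) (at 0)"
    by (rule has_vector_derivative_transform_within[OF _ \<delta>(1)])
       (use \<delta>(2) assms(3) in \<open>auto simp: dist_real_def\<close>)
qed

lemma eventually_line_in_open:
  fixes U :: "'a::real_normed_vector set"
  assumes "open U" "u \<in> U"
  shows "\<forall>\<^sub>F t in at 0. u + t *\<^sub>R e \<in> U"
proof -
  obtain \<delta> where "\<delta> > 0" "\<And>t. \<bar>t\<bar> < \<delta> \<Longrightarrow> u + t *\<^sub>R e \<in> U"
    using open_line_nbhd[OF assms] by metis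
  then show ?thesis by (auto simp: eventually_at dist_real_def)
qed

lemma uniform_limit_on_ray:
  fixes U :: "'a::real_normed_vector set" and f :: "'a \<Rightarrow> 'b::metric_space"
  assumes U: "open U" "star_at_0 U" and f: "continuous_on U f" and u: "u \<in> U"
  shows "uniform_limit {0..1} (\<lambda>t s. f (s *\<^sub>R (u + t *\<^sub>R e))) (\<lambda>s. f (s *\<^sub>R u)) (at 0)"
proof (rule uniform_limitI)
  fix \<epsilon> :: real assume \<epsilon>: "\<epsilon> > 0"
  obtain \<delta> where \<delta>: "\<delta> > 0" "\<And>t. \<bar>t\<bar> < \<delta> \<Longrightarrow> u + t *\<^sub>R e \<in> U"
    using open_line_nbhd[OF U(1) u] by metis
  have cont: "continuous_on (ball 0 \<delta> \<times> {0..1}) (\<lambda>(t, s). f (s *\<^sub>R (u + t *\<^sub>R e)))"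
    unfolding split_beta
    by (intro continuous_on_compose2[OF f] continuous_intros)
       (use star_at_0D[OF U(2) \<delta>(2)] in auto)
  have "0 \<in> ball 0 \<delta>" "0 < \<epsilon> / 2" using \<delta>(1) \<epsilon> by simp_all
  from continuous_on_prod_compactE[OF cont compact_Icc this]
  obtain T where T: "0 \<in> T" "open T"
    "\<forall>t\<in>T \<inter> ball 0 \<delta>. \<forall>s\<in>{0..1}. dist (f (s *\<^sub>R (u + t *\<^sub>R e))) (f (s *\<^sub>R u)) \<le> \<epsilon> / 2"
    unfolding prod.case scaleR_zero_left add_0_right by metis
  have "\<forall>\<^sub>F t in at 0. t \<in> T \<inter> ball 0 \<delta>"
    using T(1,2) \<delta>(1) by (intro eventually_at_in_open') auto
  then show "\<forall>\<^sub>F t in at 0. \<forall>s\<in>{0..1}. dist (f (s *\<^sub>R (u + t *\<^sub>R e))) (f (s *\<^sub>R u)) < \<epsilon>"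
  proof eventually_elim
    case (elim t)
    then show ?case using bspec[OF T(3) elim] \<epsilon> by (auto intro: le_less_trans)
  qed
qed

lemma difference_quotient_le:
  assumes D: "has_dir_deriv e f D U" and t: "t \<noteq> 0" and s: "s \<in> {0..1}"
    and inU: "\<And>\<tau>. \<bar>\<tau>\<bar> \<le> \<bar>t\<bar> \<Longrightarrow> s *\<^sub>R (u + \<tau> *\<^sub>R e) \<in> U"
    and bound: "\<And>\<tau>. \<bar>\<tau>\<bar> \<le> \<bar>t\<bar> \<Longrightarrow> norm (D (s *\<^sub>R (u + \<tau> *\<^sub>R e)) - D (s *\<^sub>R u)) \<le> \<epsilon>"
  shows "norm ((f (s *\<^sub>R (u + t *\<^sub>R e)) - f (s *\<^sub>R u)) /\<^sub>R t - s *\<^sub>R D (s *\<^sub>R u)) \<le> \<epsilon>"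
proof -
  let ?f = "\<lambda>\<tau>. f (s *\<^sub>R (u + \<tau> *\<^sub>R e))" and ?D = "\<lambda>\<tau>. s *\<^sub>R D (s *\<^sub>R (u + \<tau> *\<^sub>R e))"
  have "norm (?f t - ?f 0 - (t - 0) *\<^sub>R ?D 0) \<le> norm (t - 0) * \<epsilon>"
  proof (rule vector_differentiable_bound_linearization)
    show "closed_segment 0 t \<subseteq> {-\<bar>t\<bar>..\<bar>t\<bar>}" by (auto simp: closed_segment_eq_real_ivl)
    fix \<tau> assume "\<tau> \<in> {-\<bar>t\<bar>..\<bar>t\<bar>}"
    then have \<tau>: "\<bar>\<tau>\<bar> \<le> \<bar>t\<bar>" by auto
    from has_dir_deriv_scaled_line[OF D inU[OF this]]
    show "(?f has_vector_derivative ?D \<tau>) (at \<tau> within {-\<bar>t\<bar>..\<bar>t\<bar>})"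
      by (rule has_vector_derivative_at_within)
    have "\<bar>s\<bar> * norm (D (s *\<^sub>R (u + \<tau> *\<^sub>R e)) - D (s *\<^sub>R u)) \<le> 1 * \<epsilon>"
      using s by (intro mult_mono bound \<tau>) auto
    then show "norm (?D \<tau> - ?D 0) \<le> \<epsilon>" by (simp flip: scaleR_diff_right)
  qed simp
  moreover have "(?f t - ?f 0) /\<^sub>R t - ?D 0 = (?f t - ?f 0 - t *\<^sub>R ?D 0) /\<^sub>R t"
    using t by (simp add: scaleR_diff_right)
  ultimately show ?thesis
    using t by (simp add: pos_divide_le_eq divide_inverse_commute[symmetric] mult.commute)
qed

lemma uniform_limit_quotient_on_ray:
  assumes U: "open U" "star_at_0 U" and D: "continuous_on U D" "has_dir_deriv e f D U" and u: "u \<in> U"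
  shows "uniform_limit {0..1} (\<lambda>t s. (f (s *\<^sub>R (u + t *\<^sub>R e)) - f (s *\<^sub>R u)) /\<^sub>R t)
    (\<lambda>s. s *\<^sub>R D (s *\<^sub>R u)) (at 0)"
proof (rule uniform_limitI)
  fix \<epsilon> :: real assume \<epsilon>: "\<epsilon> > 0"
  obtain \<delta> where \<delta>: "\<delta> > 0" "\<And>t. \<bar>t\<bar> < \<delta> \<Longrightarrow> u + t *\<^sub>R e \<in> U"
    using open_line_nbhd[OF U(1) u] by metis
  have "\<forall>\<^sub>F t in at 0. \<forall>s\<in>{0..1}. dist (D (s *\<^sub>R (u + t *\<^sub>R e))) (D (s *\<^sub>R u)) < \<epsilon> / 2"
    using uniform_limitD[OF uniform_limit_on_ray[OF U D(1) u], of "\<epsilon> / 2"] \<epsilon> by simp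
  then obtain \<rho> where \<rho>: "\<rho> > 0"
    "\<And>t s. t \<noteq> 0 \<Longrightarrow> \<bar>t\<bar> < \<rho> \<Longrightarrow> s \<in> {0..1} \<Longrightarrow> norm (D (s *\<^sub>R (u + t *\<^sub>R e)) - D (s *\<^sub>R u)) < \<epsilon> / 2"
    by (auto simp: eventually_at dist_norm)
  have quotient_le: "norm ((f (s *\<^sub>R (u + t *\<^sub>R e)) - f (s *\<^sub>R u)) /\<^sub>R t - s *\<^sub>R D (s *\<^sub>R u)) \<le> \<epsilon> / 2"
    if t: "t \<noteq> 0" "\<bar>t\<bar> < min \<delta> \<rho>" and s: "s \<in> {0..1}" for t s
  proof (rule difference_quotient_le[OF D(2) t(1) s])
    fix \<tau> assume \<tau>: "\<bar>\<tau>\<bar> \<le> \<bar>t\<bar>"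
    show "s *\<^sub>R (u + \<tau> *\<^sub>R e) \<in> U" using \<tau> t by (intro star_at_0D[OF U(2) _ s] \<delta>(2)) auto
    show "norm (D (s *\<^sub>R (u + \<tau> *\<^sub>R e)) - D (s *\<^sub>R u)) \<le> \<epsilon> / 2"
      using \<rho>(2)[of \<tau> s] \<tau> t s \<epsilon> by (cases "\<tau> = 0") (auto intro: less_imp_le)
  qed
  have "dist ((f (s *\<^sub>R (u + t *\<^sub>R e)) - f (s *\<^sub>R u)) /\<^sub>R t) (s *\<^sub>R D (s *\<^sub>R u)) < \<epsilon>"
    if "t \<noteq> 0" "\<bar>t\<bar> < min \<delta> \<rho>" "s \<in> {0..1}" for t s
    using quotient_le[OF that] \<epsilon> by (simp add: dist_norm)
  then show "\<forall>\<^sub>F t in at 0. \<forall>s\<in>{0..1}.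
      dist ((f (s *\<^sub>R (u + t *\<^sub>R e)) - f (s *\<^sub>R u)) /\<^sub>R t) (s *\<^sub>R D (s *\<^sub>R u)) < \<epsilon>"
    using \<delta>(1) \<rho>(1) by (auto simp: eventually_at intro!: exI[of _ "min \<delta> \<rho>"])
qed

section \<open>Quadratic equations along rays\<close>

definition quad_rhs ::
  "('v::real_normed_vector \<Rightarrow>\<^sub>L 'v \<Rightarrow>\<^sub>L 'v) \<Rightarrow> ('a \<Rightarrow> 'v \<Rightarrow>\<^sub>L 'v) \<Rightarrow> ('a \<Rightarrow> 'v)
    \<Rightarrow> ('a \<Rightarrow> 'v) \<Rightarrow> 'a \<Rightarrow> 'v" where
  "quad_rhs b L H A u = b (A u) (A u) + L u (A u) + H u"

lemma norm_blinfun_blinfun: "norm (blinfun_apply (blinfun_apply b x) y) \<le> norm b * norm x * norm y"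
  using order_trans[OF norm_blinfun mult_right_mono[OF norm_blinfun norm_ge_zero]] .

lemma quad_rhs_diff:
  "quad_rhs b L H A u - quad_rhs b L H B u = b (A u - B u) (A u) + b (B u) (A u - B u) + L u (A u - B u)"
  by (simp add: quad_rhs_def blinfun.diff_left blinfun.diff_right)

lemma norm_quad_rhs_diff_le:
  "norm (quad_rhs b L H A u - quad_rhs b L H B u)
    \<le> (norm b * (norm (A u) + norm (B u)) + norm (L u)) * norm (A u - B u)"
proof -
  have "norm (quad_rhs b L H A u - quad_rhs b L H B u)
    \<le> norm b * norm (A u - B u) * norm (A u) + norm b * norm (B u) * norm (A u - B u)
      + norm (L u) * norm (A u - B u)"
    unfolding quad_rhs_diff by (intro norm_triangle_mono norm_blinfun_blinfun norm_blinfun)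
  then show ?thesis by (simp add: algebra_simps)
qed

lemma norm_quad_rhs_le:
  "norm (quad_rhs b L H A u) \<le> (norm b * norm (A u) + norm (L u)) * norm (A u) + norm (H u)"
proof -
  have "norm (quad_rhs b L H A u) \<le> norm b * norm (A u) * norm (A u) + norm (L u) * norm (A u) + norm (H u)"
    unfolding quad_rhs_def by (intro norm_triangle_mono norm_blinfun_blinfun norm_blinfun order_refl)
  then show ?thesis by (simp add: algebra_simps)
qed

text \<open>The derivative of the quadratic map \<open>x \<mapsto> b x x\<close> at \<open>x\<close>.\<close>

definition polar :: "('v::real_normed_vector \<Rightarrow>\<^sub>L 'v \<Rightarrow>\<^sub>L 'v) \<Rightarrow> 'v \<Rightarrow> 'v \<Rightarrow>\<^sub>L 'v" where
  "polar b x = b x + bounded_bilinear.prod_left (\<lambda>x. blinfun_apply (blinfun_apply b x)) x"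

lemma bounded_bilinear_blinfun_blinfun: "bounded_bilinear (\<lambda>x. blinfun_apply (blinfun_apply b x))"
  by (rule bounded_bilinear.comp1[OF bounded_bilinear_blinfun_apply blinfun.bounded_linear_right])

lemma polar_apply: "polar b x y = b x y + b y x"
  by (simp add: polar_def blinfun.add_left
      bounded_bilinear.prod_left.rep_eq[OF bounded_bilinear_blinfun_blinfun])

lemma bounded_linear_polar: "bounded_linear (polar b)"
  unfolding polar_def[abs_def]
  by (intro bounded_linear_add blinfun.bounded_linear_right
      bounded_bilinear.bounded_linear_prod_left bounded_bilinear_blinfun_blinfun)

lemma norm_polar_le: "norm (polar b x) \<le> 2 * norm b * norm x"
proof (rule norm_blinfun_bound)
  show "norm (polar b x y) \<le> 2 * norm b * norm x * norm y" for y
    unfolding polar_apply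
    using norm_triangle_mono[OF norm_blinfun_blinfun norm_blinfun_blinfun, of b x y b y x]
    by (simp add: mult_ac)
qed simp

text \<open>The equation \<open>\<partial>\<^sub>r (r\<^bsup>p+1\<^esup> A) = r\<^bsup>p\<^esup> (b A A + L A + H)\<close> in polar coordinates, in integrated form.\<close>

definition solves_ray_eq ::
  "'a::real_normed_vector set \<Rightarrow> nat \<Rightarrow> ('v::banach \<Rightarrow>\<^sub>L 'v \<Rightarrow>\<^sub>L 'v) \<Rightarrow> ('a \<Rightarrow> 'v \<Rightarrow>\<^sub>L 'v)
    \<Rightarrow> ('a \<Rightarrow> 'v) \<Rightarrow> ('a \<Rightarrow> 'v) \<Rightarrow> bool" where
  "solves_ray_eq U p b L H A \<longleftrightarrow> continuous_on U A \<and> (\<forall>u\<in>U. A u = ray_avg p (quad_rhs b L H A) u)"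

lemma solves_ray_eqD:
  assumes "solves_ray_eq U p b L H A"
  shows "continuous_on U A" and "u \<in> U \<Longrightarrow> A u = ray_avg p (quad_rhs b L H A) u"
  using assms unfolding solves_ray_eq_def by blast+

text \<open>A bound on the linearised operator \<open>polar b (A v) + L v\<close>. The two points are decoupled because a
  difference quotient involves the values of \<open>A\<close> at two points.\<close>

definition linearisation_norm_le ::
  "'a set \<Rightarrow> ('v::real_normed_vector \<Rightarrow>\<^sub>L 'v \<Rightarrow>\<^sub>L 'v) \<Rightarrow> ('a \<Rightarrow> 'v \<Rightarrow>\<^sub>L 'v) \<Rightarrow> ('a \<Rightarrow> 'v) \<Rightarrow> real \<Rightarrow> bool" where
  "linearisation_norm_le U b L A q \<longleftrightarrow> (\<forall>v\<in>U. \<forall>w\<in>U. 2 * norm b * norm (A v) + norm (L w) \<le> q)"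

lemma linearisation_norm_leD:
  "linearisation_norm_le U b L A q \<Longrightarrow> v \<in> U \<Longrightarrow> w \<in> U \<Longrightarrow> 2 * norm b * norm (A v) + norm (L w) \<le> q"
  by (simp add: linearisation_norm_le_def)

lemma norm_linearisation_le:
  assumes "linearisation_norm_le U b L A q" "u \<in> U"
  shows "norm (polar b (A u) + L u) \<le> q"
  using norm_triangle_mono[OF norm_polar_le order_refl] linearisation_norm_leD[OF assms(1) assms(2) assms(2)]
  by (rule order_trans)

locale ray_eq =
  fixes U :: "'a::real_normed_vector set" and b :: "'v::banach \<Rightarrow>\<^sub>L 'v \<Rightarrow>\<^sub>L 'v"
    and L :: "'a \<Rightarrow> 'v \<Rightarrow>\<^sub>L 'v" and H :: "'a \<Rightarrow> 'v"
  assumes open_U: "open U" and star_U: "star_at_0 U"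
    and cont_L: "continuous_on U L" and cont_H: "continuous_on U H"
begin

abbreviation "rhs \<equiv> quad_rhs b L H"

abbreviation "solves p \<equiv> solves_ray_eq U p b L H"

lemma continuous_on_rhs: "continuous_on U A \<Longrightarrow> continuous_on U (rhs A)"
  unfolding quad_rhs_def[abs_def] by (intro continuous_intros cont_L cont_H)

lemma norm_L_bound_nonneg: "(\<And>u. u \<in> U \<Longrightarrow> norm (L u) \<le> l) \<Longrightarrow> 0 \<le> l"
  using star_U norm_ge_zero order_trans unfolding star_at_0_def by blast

lemma norm_ray_avg_rhs_le:
  assumes A: "continuous_on U A" "\<And>v. v \<in> U \<Longrightarrow> norm (A v) \<le> a" and u: "u \<in> U"
    and L: "\<And>v. v \<in> U \<Longrightarrow> norm (L v) \<le> l" and H: "\<And>v. v \<in> U \<Longrightarrow> norm (H v) \<le> h"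
  shows "norm (ray_avg p (rhs A) u) \<le> (norm b * a + l) * a + h"
proof (rule norm_ray_avg_le[OF continuous_on_ray[OF star_U continuous_on_rhs[OF A(1)] u]])
  fix s :: real assume "s \<in> {0..1}"
  note su = star_at_0D[OF star_U u this]
  have "0 \<le> a" using order_trans[OF norm_ge_zero A(2)[OF u]] .
  then show "norm (rhs A (s *\<^sub>R u)) \<le> (norm b * a + l) * a + h"
    using A(2)[OF su] L[OF su] H[OF su] norm_L_bound_nonneg[OF L]
    by (intro order_trans[OF norm_quad_rhs_le] add_mono mult_mono mult_left_mono) auto
qed

lemma ray_avg_rhs_lipschitz:
  assumes A: "continuous_on U A" "\<And>v. v \<in> U \<Longrightarrow> norm (A v) \<le> a"
    and B: "continuous_on U B" "\<And>v. v \<in> U \<Longrightarrow> norm (B v) \<le> a" and u: "u \<in> U"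
    and L: "\<And>v. v \<in> U \<Longrightarrow> norm (L v) \<le> l" and close: "\<And>v. v \<in> U \<Longrightarrow> norm (A v - B v) \<le> \<epsilon>"
  shows "norm (ray_avg p (rhs A) u - ray_avg p (rhs B) u) \<le> (2 * norm b * a + l) * \<epsilon>"
proof -
  note ray = continuous_on_ray[OF star_U continuous_on_rhs u]
  have a: "0 \<le> a" using order_trans[OF norm_ge_zero A(2)[OF u]] .
  have "norm (rhs A v - rhs B v) \<le> (2 * norm b * a + l) * \<epsilon>" if v: "v \<in> U" for v
  proof -
    have "norm b * (norm (A v) + norm (B v)) + norm (L v) \<le> norm b * (a + a) + l"
      by (intro add_mono mult_left_mono A(2) B(2) L v) simp
    then show ?thesis
      using close[OF v] a norm_L_bound_nonneg[OF L] by (intro order_trans[OF norm_quad_rhs_diff_le] mult_mono) auto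
  qed
  then show ?thesis
    unfolding ray_avg_diff[OF ray[OF A(1)] ray[OF B(1)], symmetric]
    by (intro norm_ray_avg_le continuous_intros ray A(1) B(1)) (auto simp: star_at_0D[OF star_U u])
qed

lemma solves_exists:
  assumes L: "\<And>u. u \<in> U \<Longrightarrow> norm (L u) \<le> l" and H: "\<And>u. u \<in> U \<Longrightarrow> norm (H u) \<le> h"
    and contraction: "2 * norm b * a + l < 1" and invariant: "(norm b * a + l) * a + h \<le> a" and a: "0 \<le> a"
  obtains A where "solves p A" "\<And>u. u \<in> U \<Longrightarrow> norm (A u) \<le> a"
proof -
  have maps: "continuous_on U (ray_avg p (rhs A)) \<and> ray_avg p (rhs A) ` U \<subseteq> cball 0 a"
    if "continuous_on U A" "A ` U \<subseteq> cball 0 a" for A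
    using continuous_on_ray_avg[OF star_U continuous_on_rhs[OF that(1)]]
      order_trans[OF norm_ray_avg_rhs_le[OF that(1) _ _ L H] invariant] that(2) by fastforce
  have contracts: "dist (ray_avg p (rhs A) u) (ray_avg p (rhs B) u) \<le> (2 * norm b * a + l) * \<epsilon>"
    if A: "continuous_on U A" "A ` U \<subseteq> cball 0 a" and B: "continuous_on U B" "B ` U \<subseteq> cball 0 a"
      and "\<And>v. v \<in> U \<Longrightarrow> dist (A v) (B v) \<le> \<epsilon>" and "u \<in> U" for A B \<epsilon> u
    using that unfolding dist_norm by (intro ray_avg_rhs_lipschitz L) auto
  obtain A where "continuous_on U A" "A ` U \<subseteq> cball 0 a" "\<And>u. u \<in> U \<Longrightarrow> ray_avg p (rhs A) u = A u"
    by (rule contraction_fixpoint_continuous_on[of "cball 0 a" _ U "\<lambda>A. ray_avg p (rhs A)",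
        OF _ _ _ _ contraction maps contracts])
       (use a norm_L_bound_nonneg[OF L] in auto)
  then show thesis by (intro that[of A]) (auto simp: solves_ray_eq_def)
qed

lemma solves_norm_le:
  assumes sol: "solves p A" and u: "u \<in> U" and q: "q < 1"
    and small: "\<And>s. s \<in> {0..1} \<Longrightarrow> norm b * norm (A (s *\<^sub>R u)) + norm (L (s *\<^sub>R u)) \<le> q"
    and h: "\<And>s. s \<in> {0..1} \<Longrightarrow> norm (H (s *\<^sub>R u)) \<le> h"
  shows "norm (A u) \<le> h / (1 - q)"
proof (rule ray_avg_absorption[where g = "rhs A"])
  show "continuous_on {0..1} (\<lambda>s. A (s *\<^sub>R u))" "continuous_on {0..1} (\<lambda>s. rhs A (s *\<^sub>R u))"
    by (intro continuous_on_ray[OF star_U _ u] continuous_on_rhs solves_ray_eqD[OF sol])+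
  show "A (s *\<^sub>R u) = ray_avg p (rhs A) (s *\<^sub>R u)" if "s \<in> {0..1}" for s
    by (rule solves_ray_eqD(2)[OF sol star_at_0D[OF star_U u that]])
  show "norm (rhs A (s *\<^sub>R u)) \<le> q * norm (A (s *\<^sub>R u)) + h" if "s \<in> {0..1}" for s
    using small[OF that] h[OF that]
    by (intro order_trans[OF norm_quad_rhs_le] add_mono mult_right_mono) auto
  show "0 \<le> q" by (rule order_trans[OF _ small[of 0]]) simp_all
qed (rule q)

lemma linearised_ray_eq:
  fixes DL :: "'a \<Rightarrow> 'v \<Rightarrow>\<^sub>L 'v"
  assumes "continuous_on U A" "continuous_on U DL" "continuous_on U DH"
  shows "ray_eq U (\<lambda>u. polar b (A u) + L u) (\<lambda>u. DL u (A u) + DH u)"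
  by (rule ray_eq.intro)
     (use open_U star_U cont_L assms in
       \<open>auto intro!: continuous_intros bounded_linear.continuous_on[OF bounded_linear_polar]\<close>)

end

definition linearisation_error ::
  "('v::real_normed_vector \<Rightarrow>\<^sub>L 'v \<Rightarrow>\<^sub>L 'v) \<Rightarrow> ('a::real_vector \<Rightarrow> 'v \<Rightarrow>\<^sub>L 'v) \<Rightarrow> ('a \<Rightarrow> 'v) \<Rightarrow> ('a \<Rightarrow> 'v)
    \<Rightarrow> ('a \<Rightarrow> 'v \<Rightarrow>\<^sub>L 'v) \<Rightarrow> ('a \<Rightarrow> 'v) \<Rightarrow> ('a \<Rightarrow> 'v) \<Rightarrow> 'a \<Rightarrow> 'a \<Rightarrow> real \<Rightarrow> real \<Rightarrow> 'v" where
  "linearisation_error b L H A DL DH G u w t s =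
    b (s *\<^sub>R G (s *\<^sub>R u)) (A (s *\<^sub>R w) - A (s *\<^sub>R u)) + (L (s *\<^sub>R w) - L (s *\<^sub>R u)) (s *\<^sub>R G (s *\<^sub>R u))
    + ((L (s *\<^sub>R w) - L (s *\<^sub>R u)) /\<^sub>R t - s *\<^sub>R DL (s *\<^sub>R u)) (A (s *\<^sub>R u))
    + ((H (s *\<^sub>R w) - H (s *\<^sub>R u)) /\<^sub>R t - s *\<^sub>R DH (s *\<^sub>R u))"

lemma quad_rhs_difference_quotient:
  fixes A G :: "'a::real_vector \<Rightarrow> 'v::real_normed_vector" and DL :: "'a \<Rightarrow> 'v \<Rightarrow>\<^sub>L 'v"
  assumes "t \<noteq> 0" and "d = (A (s *\<^sub>R w) - A (s *\<^sub>R u)) /\<^sub>R t - s *\<^sub>R G (s *\<^sub>R u)"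
  shows "(quad_rhs b L H A (s *\<^sub>R w) - quad_rhs b L H A (s *\<^sub>R u)) /\<^sub>R t
      - s *\<^sub>R quad_rhs 0 (\<lambda>v. polar b (A v) + L v) (\<lambda>v. DL v (A v) + DH v) G (s *\<^sub>R u)
    = (b d (A (s *\<^sub>R w)) + b (A (s *\<^sub>R u)) d + L (s *\<^sub>R w) d) + linearisation_error b L H A DL DH G u w t s"
  using assms(1) unfolding assms(2)
  by (simp add: quad_rhs_def linearisation_error_def polar_apply blinfun.bilinear_simps
      scaleR_diff_right scaleR_add_right)

text \<open>The error of the difference quotient solves the linearised equation up to \<open>linearisation_error\<close>,
  so the latter controls it by absorption.\<close>

lemma (in ray_eq) difference_quotient_error_le:
  fixes DL :: "'a \<Rightarrow> 'v \<Rightarrow>\<^sub>L 'v"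
  assumes sol: "solves p A" and small: "linearisation_norm_le U b L A q" and q: "q < 1"
    and DL: "continuous_on U DL" and DH: "continuous_on U DH"
    and G: "solves_ray_eq U (Suc p) 0 (\<lambda>v. polar b (A v) + L v) (\<lambda>v. DL v (A v) + DH v) G"
    and u: "u \<in> U" and w: "w \<in> U" and t: "t \<noteq> 0"
    and error: "\<And>s. s \<in> {0..1} \<Longrightarrow> norm (linearisation_error b L H A DL DH G u w t s) \<le> \<epsilon>"
  shows "norm ((A w - A u) /\<^sub>R t - G u) \<le> \<epsilon> / (1 - q)"
proof -
  interpret lin: ray_eq U 0 "\<lambda>v. polar b (A v) + L v" "\<lambda>v. DL v (A v) + DH v"
    by (intro linearised_ray_eq solves_ray_eqD(1)[OF sol] DL DH)
  note A = solves_ray_eqD[OF sol] and G = solves_ray_eqD[OF G]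
  note cont_A = continuous_on_ray[OF star_U A(1)] and cont_G = continuous_on_ray[OF star_U G(1) u]
    and cont_rhs = continuous_on_ray[OF star_U continuous_on_rhs[OF A(1)]]
    and cont_lin = continuous_on_ray[OF star_U lin.continuous_on_rhs[OF G(1)] u]
  define d where "d s = (A (s *\<^sub>R w) - A (s *\<^sub>R u)) /\<^sub>R t - s *\<^sub>R G (s *\<^sub>R u)" for s
  define \<rho> where "\<rho> s = (rhs A (s *\<^sub>R w) - rhs A (s *\<^sub>R u)) /\<^sub>R t - s *\<^sub>R lin.rhs G (s *\<^sub>R u)" for s
  have "norm (d 1) \<le> \<epsilon> / (1 - q)"
  proof (rule ray_avg_absorption[where g = \<rho> and p = p and u = "1 :: real"])
    show "continuous_on {0..1} (\<lambda>s. d (s *\<^sub>R 1))"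
      unfolding d_def real_scaleR_def mult_1_right by (intro continuous_intros cont_A cont_G u w)
    show "continuous_on {0..1} (\<lambda>s. \<rho> (s *\<^sub>R 1))"
      unfolding \<rho>_def real_scaleR_def mult_1_right by (intro continuous_intros cont_rhs cont_lin u w)
    show "0 \<le> q" by (rule order_trans[OF _ linearisation_norm_leD[OF small u u]]) simp
    fix s :: real assume s: "s \<in> {0..1}"
    note su = star_at_0D[OF star_U u s] and sw = star_at_0D[OF star_U w s]
    have "ray_avg p \<rho> s = (ray_avg p (rhs A) (s *\<^sub>R w) - ray_avg p (rhs A) (s *\<^sub>R u)) /\<^sub>R t
        - s *\<^sub>R ray_avg (Suc p) (lin.rhs G) (s *\<^sub>R u)"
      unfolding \<rho>_def
      by (intro ray_avg_difference_quotient[OF star_U] continuous_on_rhs lin.continuous_on_rhs A(1) G(1) u w s)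
    then show "d (s *\<^sub>R 1) = ray_avg p \<rho> (s *\<^sub>R 1)"
      using A(2)[OF su] A(2)[OF sw] G(2)[OF su] by (simp add: d_def)
    have "\<rho> s = (b (d s) (A (s *\<^sub>R w)) + b (A (s *\<^sub>R u)) (d s) + L (s *\<^sub>R w) (d s))
        + linearisation_error b L H A DL DH G u w t s"
      unfolding \<rho>_def by (rule quad_rhs_difference_quotient[OF t]) (rule d_def)
    also have "norm \<dots> \<le> norm b * norm (d s) * norm (A (s *\<^sub>R w)) + norm b * norm (A (s *\<^sub>R u)) * norm (d s)
        + norm (L (s *\<^sub>R w)) * norm (d s) + \<epsilon>"
      by (intro norm_triangle_mono norm_blinfun_blinfun norm_blinfun error s)
    also have "\<dots> = (norm b * norm (A (s *\<^sub>R w)) + norm b * norm (A (s *\<^sub>R u)) + norm (L (s *\<^sub>R w)))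
        * norm (d s) + \<epsilon>"
      by (simp add: algebra_simps)
    also have "\<dots> \<le> q * norm (d s) + \<epsilon>"
      using linearisation_norm_leD[OF small su sw] linearisation_norm_leD[OF small sw sw]
      by (intro add_right_mono mult_right_mono) auto
    finally show "norm (\<rho> (s *\<^sub>R 1)) \<le> q * norm (d (s *\<^sub>R 1)) + \<epsilon>" by simp
  qed (rule q)
  then show ?thesis by (simp add: d_def)
qed

lemma (in ray_eq) linearisation_error_uniform_limit:
  fixes DL :: "'a \<Rightarrow> 'v \<Rightarrow>\<^sub>L 'v"
  assumes A: "continuous_on U A" and G: "continuous_on U G"
    and DL: "continuous_on U DL" "has_dir_deriv e L DL U"
    and DH: "continuous_on U DH" "has_dir_deriv e H DH U" and u: "u \<in> U"
  shows "uniform_limit {0..1} (\<lambda>t. linearisation_error b L H A DL DH G u (u + t *\<^sub>R e) t) (\<lambda>s. 0) (at 0)"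
proof -
  have bounded_ray: "bounded ((\<lambda>s. f (s *\<^sub>R u)) ` {0..1})"
    if "continuous_on U f" for f :: "'a \<Rightarrow> 'c::real_normed_vector"
    by (intro compact_imp_bounded compact_continuous_image continuous_on_ray[OF star_U that u] compact_Icc)
  have bounded_G: "bounded ((\<lambda>s. s *\<^sub>R G (s *\<^sub>R u)) ` {0..1})"
    by (intro compact_imp_bounded compact_continuous_image continuous_intros
        continuous_on_ray[OF star_U G u] compact_Icc)
  have bounded_0: "bounded ((\<lambda>s. 0 :: 'd::real_normed_vector) ` {0..1::real})"
    by (auto simp: image_constant_conv)
  have diff: "uniform_limit {0..1} (\<lambda>t s. f (s *\<^sub>R (u + t *\<^sub>R e)) - f (s *\<^sub>R u)) (\<lambda>s. 0) (at 0)"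
    if "continuous_on U f" for f :: "'a \<Rightarrow> 'c::real_normed_vector"
    using uniform_limit_minus[OF uniform_limit_on_ray[OF open_U star_U that u] uniform_limit_const,
        of e "\<lambda>s. f (s *\<^sub>R u)"]
    by simp
  have quotient: "uniform_limit {0..1}
      (\<lambda>t s. (f (s *\<^sub>R (u + t *\<^sub>R e)) - f (s *\<^sub>R u)) /\<^sub>R t - s *\<^sub>R D (s *\<^sub>R u)) (\<lambda>s. 0) (at 0)"
    if "continuous_on U D" "has_dir_deriv e f D U" for f D :: "'a \<Rightarrow> 'c::real_normed_vector"
    using uniform_limit_minus[OF uniform_limit_quotient_on_ray[OF open_U star_U that u] uniform_limit_const,
        of "\<lambda>s. s *\<^sub>R D (s *\<^sub>R u)"]
    by simp
  have "uniform_limit {0..1} (\<lambda>t. linearisation_error b L H A DL DH G u (u + t *\<^sub>R e) t)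
    (\<lambda>s. b (s *\<^sub>R G (s *\<^sub>R u)) 0 + blinfun_apply 0 (s *\<^sub>R G (s *\<^sub>R u))
      + blinfun_apply 0 (A (s *\<^sub>R u)) + 0) (at 0)"
    unfolding linearisation_error_def
    by (intro uniform_limit_add bounded_bilinear.bounded_uniform_limit[OF bounded_bilinear_blinfun_apply]
        bounded_bilinear.bounded_uniform_limit[OF bounded_bilinear_blinfun_blinfun]
        uniform_limit_const diff quotient bounded_ray bounded_G bounded_0 A cont_L DL DH)
  then show ?thesis by simp
qed

lemma (in ray_eq) solves_has_dir_deriv:
  fixes DL :: "'a \<Rightarrow> 'v \<Rightarrow>\<^sub>L 'v"
  assumes sol: "solves p A" and small: "linearisation_norm_le U b L A q" and q: "q < 1"
    and DL: "continuous_on U DL" "has_dir_deriv e L DL U"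
    and DH: "continuous_on U DH" "has_dir_deriv e H DH U"
    and G: "solves_ray_eq U (Suc p) 0 (\<lambda>v. polar b (A v) + L v) (\<lambda>v. DL v (A v) + DH v) G"
  shows "has_dir_deriv e A G U"
  unfolding has_dir_deriv_def has_vector_derivative_at_0_iff
proof (intro ballI tendstoI)
  fix u and \<epsilon> :: real assume u: "u \<in> U" and \<epsilon>: "\<epsilon> > 0"
  define \<epsilon>' where "\<epsilon>' = \<epsilon> / 2 * (1 - q)"
  have \<epsilon>': "0 < \<epsilon>'" using \<epsilon> q by (simp add: \<epsilon>'_def)
  have \<epsilon>'_div: "\<epsilon>' / (1 - q) = \<epsilon> / 2"
    unfolding \<epsilon>'_def using q by (intro nonzero_mult_div_cancel_right) simp
  note uniform_limitD[OF linearisation_error_uniform_limit[OF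
        solves_ray_eqD(1)[OF sol] solves_ray_eqD(1)[OF G] DL DH u] \<epsilon>']
  moreover have "\<forall>\<^sub>F t in at (0::real). t \<noteq> 0" by (simp add: eventually_at_filter)
  ultimately show "\<forall>\<^sub>F t in at 0. dist ((A (u + t *\<^sub>R e) - A (u + 0 *\<^sub>R e)) /\<^sub>R t) (G u) < \<epsilon>"
    using eventually_line_in_open[OF open_U u, of e]
  proof eventually_elim
    case (elim t)
    have "norm ((A (u + t *\<^sub>R e) - A u) /\<^sub>R t - G u) \<le> \<epsilon>' / (1 - q)"
      by (rule difference_quotient_error_le[OF sol small q DL(1) DH(1) G u elim(3,2)])
         (use elim(1) in \<open>auto intro: less_imp_le\<close>)
    then show ?case using \<epsilon> \<epsilon>'_div by (simp add: dist_norm)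
  qed
qed

lemma (in ray_eq) solves_norm_le_uniform:
  assumes sol: "solves p A" and small: "linearisation_norm_le U b L A q" and q: "q < 1"
    and H: "\<And>v. v \<in> U \<Longrightarrow> norm (H v) \<le> h" and u: "u \<in> U"
  shows "norm (A u) \<le> h / (1 - q)"
proof (rule solves_norm_le[OF sol u q])
  fix s :: real assume "s \<in> {0..1}"
  note su = star_at_0D[OF star_U u this]
  have "norm b * norm (A (s *\<^sub>R u)) \<le> 2 * norm b * norm (A (s *\<^sub>R u))" by simp
  then show "norm b * norm (A (s *\<^sub>R u)) + norm (L (s *\<^sub>R u)) \<le> q"
    using linearisation_norm_leD[OF small su su] by linarith
  show "norm (H (s *\<^sub>R u)) \<le> h" by (rule H[OF su])
qed

lemma (in ray_eq) solves_dir_deriv_exists: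
  fixes DL :: "'a \<Rightarrow> 'v \<Rightarrow>\<^sub>L 'v"
  assumes sol: "solves p A" and small: "linearisation_norm_le U b L A q" and q: "q < 1"
    and A: "\<And>v. v \<in> U \<Longrightarrow> norm (A v) \<le> N"
    and DL: "continuous_on U DL" "has_dir_deriv e L DL U" "\<And>v. v \<in> U \<Longrightarrow> norm (DL v) \<le> M"
    and DH: "continuous_on U DH" "has_dir_deriv e H DH U" "\<And>v. v \<in> U \<Longrightarrow> norm (DH v) \<le> M"
  obtains G where "has_dir_deriv e A G U"
    "solves_ray_eq U (Suc p) 0 (\<lambda>v. polar b (A v) + L v) (\<lambda>v. DL v (A v) + DH v) G"
proof -
  interpret lin: ray_eq U 0 "\<lambda>v. polar b (A v) + L v" "\<lambda>v. DL v (A v) + DH v"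
    by (intro linearised_ray_eq solves_ray_eqD(1)[OF sol] DL(1) DH(1))
  have nonneg: "0 \<le> M" "0 \<le> N"
    using DL(3)[of 0] A[of 0] star_U norm_ge_zero order_trans unfolding star_at_0_def by blast+
  have H': "norm (DL v (A v) + DH v) \<le> M * N + M" if "v \<in> U" for v
    using that nonneg by (intro norm_triangle_mono order_trans[OF norm_blinfun] mult_mono DL(3) DH(3) A) auto
  obtain G where "lin.solves (Suc p) G"
  proof (rule lin.solves_exists[OF norm_linearisation_le[OF small] H'])
    define g where "g = (M * N + M) / (1 - q)"
    have "(1 - q) * g = M * N + M" using q by (simp add: g_def)
    then show "(norm (0 :: 'v \<Rightarrow>\<^sub>L 'v \<Rightarrow>\<^sub>L 'v) * g + q) * g + (M * N + M) \<le> g"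
      by (simp add: algebra_simps)
    show "0 \<le> g" using nonneg q by (simp add: g_def)
    show "2 * norm (0 :: 'v \<Rightarrow>\<^sub>L 'v \<Rightarrow>\<^sub>L 'v) * g + q < 1" using q by simp
  qed
  then show thesis
    using that solves_has_dir_deriv[OF sol small q DL(1,2) DH(1,2)] by blast
qed

section \<open>Bounds on partial derivatives\<close>

primrec Ck_bound :: "nat \<Rightarrow> real \<Rightarrow> ('a::euclidean_space \<Rightarrow> 'b::real_normed_vector) \<Rightarrow> 'a set \<Rightarrow> bool" where
  "Ck_bound 0 M f U \<longleftrightarrow> continuous_on U f \<and> (\<forall>u\<in>U. norm (f u) \<le> M)"
| "Ck_bound (Suc m) M f U \<longleftrightarrow> continuous_on U f \<and> (\<forall>u\<in>U. norm (f u) \<le> M) \<and>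
     (\<forall>e\<in>Basis. \<exists>D. has_dir_deriv e f D U \<and> Ck_bound m M D U)"

lemma Ck_boundD:
  assumes "Ck_bound m M f U"
  shows "continuous_on U f" and "u \<in> U \<Longrightarrow> norm (f u) \<le> M"
  using assms by (cases m; auto)+

lemma Ck_bound_SucE:
  assumes "Ck_bound (Suc m) M f U" "e \<in> Basis"
  obtains D where "has_dir_deriv e f D U" "Ck_bound m M D U"
  using assms by (meson Ck_bound.simps(2))

lemma Ck_bound_SucI:
  assumes "continuous_on U f" "\<And>u. u \<in> U \<Longrightarrow> norm (f u) \<le> M"
    and "\<And>e. e \<in> Basis \<Longrightarrow> \<exists>D. has_dir_deriv e f D U \<and> Ck_bound m M D U"
  shows "Ck_bound (Suc m) M f U"
  using assms by simp

lemma Ck_bound_SucD: "Ck_bound (Suc m) M f U \<Longrightarrow> Ck_bound m M f U"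
proof (induction m arbitrary: f)
  case (Suc m)
  then show ?case by (simp only: Ck_bound.simps(2)[of "Suc m"] Ck_bound.simps(2)[of m]) blast
qed simp

lemma Ck_bound_antimono: "Ck_bound n M f U \<Longrightarrow> m \<le> n \<Longrightarrow> Ck_bound m M f U"
  by (induction n) (auto simp: le_Suc_eq simp del: Ck_bound.simps dest: Ck_bound_SucD)

lemma Ck_bound_mono: "Ck_bound m M f U \<Longrightarrow> M \<le> N \<Longrightarrow> Ck_bound m N f U"
proof (induction m arbitrary: f)
  case (Suc m)
  show ?case
  proof (rule Ck_bound_SucI)
    fix e :: 'a assume "e \<in> Basis"
    then show "\<exists>D. has_dir_deriv e f D U \<and> Ck_bound m N D U"
      using Suc.IH[OF _ Suc.prems(2)] Ck_bound_SucE[OF Suc.prems(1)] by metis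
  qed (use Suc.prems Ck_boundD[OF Suc.prems(1)] in \<open>auto intro: order_trans\<close>)
qed (auto intro: order_trans)

lemma Ck_bound_const:
  fixes c :: "'b::real_normed_vector" and U :: "'a::euclidean_space set"
  shows "norm c \<le> M \<Longrightarrow> Ck_bound m M (\<lambda>u. c) U"
proof (induction m arbitrary: c)
  case (Suc m)
  have "0 \<le> M" using Suc.prems norm_ge_zero order_trans by blast
  then have "has_dir_deriv e (\<lambda>u. c) (\<lambda>u. 0) U \<and> Ck_bound m M (\<lambda>u. 0 :: 'b) U" for e
    using Suc.IH[of 0] by (simp add: has_dir_deriv_def)
  then show ?case using Suc.prems by auto
qed simp

lemma Ck_bound_ident:
  fixes U :: "'a::euclidean_space set"
  assumes "\<And>u. u \<in> U \<Longrightarrow> norm u \<le> R"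
  shows "Ck_bound m (max R 1) (\<lambda>u. u) U"
proof (cases m)
  case 0
  then show ?thesis using assms by (auto simp: le_max_iff_disj)
next
  case (Suc n)
  have "has_dir_deriv e (\<lambda>u. u) (\<lambda>u. e) U" for e
    unfolding has_dir_deriv_def by (auto intro!: derivative_eq_intros)
  moreover have "Ck_bound n (max R 1) (\<lambda>u. e) U" if "e \<in> Basis" for e :: 'a
    using that by (intro Ck_bound_const) (simp add: le_max_iff_disj)
  ultimately show ?thesis
    unfolding Suc using assms by (intro Ck_bound_SucI) (auto simp: le_max_iff_disj)
qed

lemma Ck_bound_add:
  "Ck_bound m M f U \<Longrightarrow> Ck_bound m N g U \<Longrightarrow> Ck_bound m (M + N) (\<lambda>u. f u + g u) U"
proof (induction m arbitrary: f g)
  case (Suc m)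
  have "\<exists>D. has_dir_deriv e (\<lambda>u. f u + g u) D U \<and> Ck_bound m (M + N) D U" if e: "e \<in> Basis" for e
  proof -
    obtain D where D: "has_dir_deriv e f D U" "Ck_bound m M D U"
      by (rule Ck_bound_SucE[OF Suc.prems(1) e])
    obtain E where E: "has_dir_deriv e g E U" "Ck_bound m N E U"
      by (rule Ck_bound_SucE[OF Suc.prems(2) e])
    show ?thesis using has_dir_deriv_add[OF D(1) E(1)] Suc.IH[OF D(2) E(2)] by blast
  qed
  then show ?case using Suc.prems by (auto intro!: continuous_intros norm_triangle_mono)
qed (auto intro!: continuous_intros norm_triangle_mono)

lemma Ck_bound_sum:
  assumes "finite I" "\<And>i. i \<in> I \<Longrightarrow> Ck_bound m (M i) (f i) U"
  shows "Ck_bound m (\<Sum>i\<in>I. M i) (\<lambda>u. \<Sum>i\<in>I. f i u) U"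
  using assms
proof (induction I rule: finite_induct)
  case empty
  show ?case by (simp add: Ck_bound_const)
qed (auto intro!: Ck_bound_add)

lemma Ck_bound_linear:
  assumes linear: "bounded_linear T" "\<And>x. norm (T x) \<le> K * norm x" "0 \<le> K"
  shows "Ck_bound m M f U \<Longrightarrow> Ck_bound m (K * M) (\<lambda>u. T (f u)) U"
proof (induction m arbitrary: f)
  case 0
  then show ?case
    by (auto intro!: bounded_linear.continuous_on[OF linear(1)]
        order_trans[OF linear(2)] mult_left_mono linear(3))
next
  case (Suc m)
  have "\<exists>D. has_dir_deriv e (\<lambda>u. T (f u)) D U \<and> Ck_bound m (K * M) D U" if "e \<in> Basis" for e
    using Ck_bound_SucE[OF Suc.prems that] Suc.IH has_dir_deriv_linear[OF linear(1)] by metis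
  then show ?case using Suc.prems
    by (auto intro!: bounded_linear.continuous_on[OF linear(1)]
        order_trans[OF linear(2)] mult_left_mono linear(3))
qed

lemma Ck_bound_bilinear:
  assumes bilinear: "bounded_bilinear b" "\<And>x y. norm (b x y) \<le> K * norm x * norm y" "0 \<le> K"
    and nonneg: "0 \<le> M" "0 \<le> N"
  shows "Ck_bound m M f U \<Longrightarrow> Ck_bound m N g U \<Longrightarrow> Ck_bound m (2 ^ m * (K * M * N)) (\<lambda>u. b (f u) (g u)) U"
proof (induction m arbitrary: f g)
  have "norm (b x y) \<le> K * M * N" if "norm x \<le> M" "norm y \<le> N" for x y
    using bilinear(2)[of x y] mult_mono[OF mult_left_mono[OF that(1) bilinear(3)] that(2)] bilinear(3) nonneg
    by simp
  moreover case 0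
  ultimately show ?case by (auto intro!: bounded_bilinear.continuous_on[OF bilinear(1)])
next
  case (Suc m)
  have double: "2 ^ m * (K * M * N) + 2 ^ m * (K * M * N) = 2 ^ Suc m * (K * M * N)" by simp
  have low: "Ck_bound m (2 ^ m * (K * M * N)) (\<lambda>u. b (f u) (g u)) U"
    by (intro Suc.IH Suc.prems[THEN Ck_bound_SucD])
  show ?case
  proof (rule Ck_bound_SucI)
    show "continuous_on U (\<lambda>u. b (f u) (g u))" by (rule Ck_boundD(1)[OF low])
    show "norm (b (f u) (g u)) \<le> 2 ^ Suc m * (K * M * N)" if "u \<in> U" for u
      using order_trans[OF Ck_boundD(2)[OF low that]] bilinear(3) nonneg by simp
    show "\<exists>D. has_dir_deriv e (\<lambda>u. b (f u) (g u)) D U \<and> Ck_bound m (2 ^ Suc m * (K * M * N)) D U"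
      if e: "e \<in> Basis" for e
    proof -
      obtain D where D: "has_dir_deriv e f D U" "Ck_bound m M D U" by (rule Ck_bound_SucE[OF Suc.prems(1) e])
      obtain E where E: "has_dir_deriv e g E U" "Ck_bound m N E U" by (rule Ck_bound_SucE[OF Suc.prems(2) e])
      have "Ck_bound m (2 ^ Suc m * (K * M * N)) (\<lambda>u. b (f u) (E u) + b (D u) (g u)) U"
        unfolding double[symmetric] by (intro Ck_bound_add Suc.IH D E Suc.prems[THEN Ck_bound_SucD])
      then show ?thesis using has_dir_deriv_bilinear[OF bilinear(1) D(1) E(1)] by blast
    qed
  qed
qed

lemma Ck_bound_cong:
  assumes "open U" and f: "Ck_bound m M f U" and eq: "\<And>u. u \<in> U \<Longrightarrow> f u = g u"
  shows "Ck_bound m M g U"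
proof (cases m)
  case 0
  then show ?thesis using f eq by (auto cong: continuous_on_cong)
next
  case (Suc n)
  show ?thesis
    unfolding Suc
  proof (rule Ck_bound_SucI)
    show "continuous_on U g" using Ck_boundD(1)[OF f] eq by (simp cong: continuous_on_cong)
    show "norm (g u) \<le> M" if "u \<in> U" for u using Ck_boundD(2)[OF f that] eq that by simp
    show "\<exists>D. has_dir_deriv e g D U \<and> Ck_bound n M D U" if e: "e \<in> Basis" for e
    proof -
      obtain D where D: "has_dir_deriv e f D U" "Ck_bound n M D U"
        by (rule Ck_bound_SucE[OF f[unfolded Suc] e])
      have "has_dir_deriv e g D U" by (rule has_dir_deriv_cong[OF assms(1) D(1) eq])
      then show ?thesis using D(2) by blast
    qed
  qed
qed

lemma pderivs_append: "pderivs (\<beta> @ \<beta>') f = pderivs \<beta> (pderivs \<beta>' f)"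
  by (induction \<beta>) auto

lemma pderivs_cong:
  assumes "open U" "\<And>u. u \<in> U \<Longrightarrow> f u = g u"
  shows "u \<in> U \<Longrightarrow> pderivs \<beta> f u = pderivs \<beta> g u"
proof (induction \<beta> arbitrary: u)
  case (Cons i \<beta>)
  obtain \<delta> where \<delta>: "\<delta> > 0" "\<And>t. \<bar>t\<bar> < \<delta> \<Longrightarrow> u + t *\<^sub>R axis i 1 \<in> U"
    using open_line_nbhd[OF assms(1) Cons.prems] by metis
  have "\<forall>\<^sub>F t in nhds 0. pderivs \<beta> f (u + t *\<^sub>R axis i 1) = pderivs \<beta> g (u + t *\<^sub>R axis i 1)"
    using \<delta> Cons.IH by (auto simp: eventually_nhds_metric dist_real_def intro!: exI[of _ \<delta>])
  then show ?case by (simp add: deriv_cong_ev)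
qed (use assms in auto)

lemma pderivs_eq_dir_deriv:
  assumes "has_dir_deriv (axis i 1) f D U" "u \<in> U"
  shows "pderivs [i] f u = D u"
  using assms
  by (auto simp: has_dir_deriv_def simp flip: has_real_derivative_iff_has_vector_derivative intro: DERIV_imp_deriv)

lemma has_dir_deriv_pderivs:
  assumes "\<And>u. u \<in> U \<Longrightarrow> (\<lambda>t. f (u + t *\<^sub>R axis i 1)) differentiable (at 0)"
  shows "has_dir_deriv (axis i 1) f (pderivs [i] f) U"
  using assms unfolding has_dir_deriv_def
  by (simp add: DERIV_deriv_iff_real_differentiable flip: has_real_derivative_iff_has_vector_derivative)

lemma is_CmD:
  assumes "is_Cm m f U"
  shows "length \<beta> \<le> m \<Longrightarrow> continuous_on U (pderivs \<beta> f)"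
    and "length \<beta> < m \<Longrightarrow> u \<in> U \<Longrightarrow> (\<lambda>t. pderivs \<beta> f (u + t *\<^sub>R axis i 1)) differentiable (at 0)"
  using assms unfolding is_Cm_def by blast+

lemma is_Cm_imp_Ck_bound:
  fixes f :: "real^'k \<Rightarrow> real"
  assumes "is_Cm m f U" "\<And>\<beta> u. length \<beta> \<le> m \<Longrightarrow> u \<in> U \<Longrightarrow> \<bar>pderivs \<beta> f u\<bar> \<le> M"
  shows "Ck_bound m M f U"
  using assms
proof (induction m arbitrary: f)
  case 0
  then show ?case using is_CmD(1)[OF "0"(1), of "[]"] "0"(2)[of "[]"] by simp
next
  case (Suc m)
  show ?case
  proof (rule Ck_bound_SucI)
    show "continuous_on U f" using is_CmD(1)[OF Suc.prems(1), of "[]"] by simp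
    show "norm (f u) \<le> M" if "u \<in> U" for u using Suc.prems(2)[of "[]" u] that by simp
    show "\<exists>D. has_dir_deriv e f D U \<and> Ck_bound m M D U" if basis: "e \<in> Basis" for e :: "real^'k"
    proof -
      obtain i where e: "e = axis i 1" using basis by (auto simp: Basis_vec_def)
      have "has_dir_deriv e f (pderivs [i] f) U"
        unfolding e using is_CmD(2)[OF Suc.prems(1), of "[]"] by (intro has_dir_deriv_pderivs) simp
      moreover have "Ck_bound m M (pderivs [i] f) U"
      proof (rule Suc.IH)
        show "is_Cm m (pderivs [i] f) U"
          unfolding is_Cm_def pderivs_append[symmetric] using is_CmD[OF Suc.prems(1)] by simp
        show "\<bar>pderivs \<beta> (pderivs [i] f) u\<bar> \<le> M" if "length \<beta> \<le> m" "u \<in> U" for \<beta> u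
          using Suc.prems(2)[of "\<beta> @ [i]" u] that by (simp add: pderivs_append del: pderivs.simps)
      qed
      ultimately show ?thesis by blast
    qed
  qed
qed

lemma Ck_bound_pderivs:
  assumes U: "open U" and f: "Ck_bound (length \<beta> + m) M f U"
  shows "Ck_bound m M (pderivs \<beta> f) U"
  using f
proof (induction \<beta> arbitrary: f rule: rev_induct)
  case (snoc i \<beta>)
  have "Ck_bound (Suc (length \<beta> + m)) M f U" using snoc.prems by (simp del: Ck_bound.simps)
  then obtain D where D: "has_dir_deriv (axis i 1) f D U" "Ck_bound (length \<beta> + m) M D U"
    by (rule Ck_bound_SucE[where e = "axis i 1"]) simp
  show ?case
    unfolding pderivs_append
  proof (rule Ck_bound_cong[OF U snoc.IH[OF D(2)]])
    show "pderivs \<beta> D u = pderivs \<beta> (pderivs [i] f) u" if "u \<in> U" for u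
      by (rule pderivs_cong[OF U pderivs_eq_dir_deriv[OF D(1), symmetric] that])
  qed
qed simp

lemma Ck_bound_imp_pderivs_le:
  fixes f :: "real^'k \<Rightarrow> real"
  assumes "open U" "Ck_bound m M f U" "length \<beta> \<le> m" "u \<in> U"
  shows "\<bar>pderivs \<beta> f u\<bar> \<le> M"
  using Ck_boundD(2)[OF Ck_bound_pderivs[of U \<beta> "m - length \<beta>"]] assms by simp

lemma Ck_bound_imp_is_Cm:
  fixes f :: "real^'k \<Rightarrow> real"
  assumes U: "open U" and f: "Ck_bound m M f U"
  shows "is_Cm m f U"
proof -
  have pderivs: "Ck_bound (m - length \<beta>) M (pderivs \<beta> f) U" if "length \<beta> \<le> m" for \<beta>
    by (rule Ck_bound_pderivs[OF U]) (use f that in simp)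
  have "(\<lambda>t. pderivs \<beta> f (u + t *\<^sub>R axis i 1)) differentiable (at 0)" if \<beta>: "length \<beta> < m" and "u \<in> U" for \<beta> u i
  proof -
    have "Ck_bound (Suc 0) M (pderivs \<beta> f) U"
      using \<beta> by (intro Ck_bound_antimono[OF pderivs]) auto
    then obtain D where "has_dir_deriv (axis i 1) (pderivs \<beta> f) D U"
      by (rule Ck_bound_SucE[where e = "axis i 1"]) simp
    then show ?thesis
      using \<open>u \<in> U\<close> by (auto simp: has_dir_deriv_def intro: differentiableI_vector)
  qed
  then show ?thesis
    unfolding is_Cm_def using Ck_boundD(1)[OF pderivs] by blast
qed

lemma Cm_norm_le_imp_Ck_bound:
  fixes f :: "real^'k \<Rightarrow> real"
  assumes "is_Cm m f U" "Cm_norm_le m f U M"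
  shows "Ck_bound m M f U"
proof (rule is_Cm_imp_Ck_bound[OF assms(1)])
  fix \<beta> :: "'k list" and u assume "length \<beta> \<le> m" "u \<in> U"
  moreover have "finite {\<beta> :: 'k list. length \<beta> \<le> m}"
    using finite_lists_length_le[of "UNIV :: 'k set" m] by simp
  ultimately have "\<bar>pderivs \<beta> f u\<bar> \<le> (\<Sum>\<beta>\<in>{\<beta>. length \<beta> \<le> m}. \<bar>pderivs \<beta> f u\<bar>)"
    by (intro member_le_sum[of \<beta> _ "\<lambda>\<beta>. \<bar>pderivs \<beta> f u\<bar>"]) auto
  also have "\<dots> \<le> M" using assms(2) \<open>u \<in> U\<close> unfolding Cm_norm_le_def by blast
  finally show "\<bar>pderivs \<beta> f u\<bar> \<le> M" .
qed

lemma Ck_bound_matrix_imp_Cm: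
  fixes A :: "real^'k \<Rightarrow> real^'k^'k"
  assumes U: "open U" and A: "Ck_bound m M A U"
  shows "is_Cm m (\<lambda>u. A u $ i $ j) U"
    and "Cm_norm_le_mat m A U (real (card {\<beta> :: 'k list. length \<beta> \<le> m}) * (real CARD('k))\<^sup>2 * M)"
proof -
  have entry: "Ck_bound m (1 * M) (\<lambda>u. A u $ i $ j) U" for i j
    by (rule Ck_bound_linear[where T = "\<lambda>M. M $ i $ j", OF _ _ _ A])
       (auto intro!: bounded_linear_compose[OF bounded_linear_vec_nth bounded_linear_vec_nth, unfolded o_def]
         order_trans[OF component_le_norm_cart] Finite_Cartesian_Product.norm_nth_le)
  show "is_Cm m (\<lambda>u. A u $ i $ j) U" by (rule Ck_bound_imp_is_Cm[OF U entry])
  have "(\<Sum>\<beta>\<in>{\<beta>. length \<beta> \<le> m}. \<Sum>i\<in>UNIV. \<Sum>j\<in>UNIV. \<bar>pderivs \<beta> (\<lambda>u. A u $ i $ j) u\<bar>)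
    \<le> (\<Sum>\<beta>\<in>{\<beta> :: 'k list. length \<beta> \<le> m}. \<Sum>i\<in>(UNIV :: 'k set). \<Sum>j\<in>(UNIV :: 'k set). M)" if "u \<in> U" for u
    using Ck_bound_imp_pderivs_le[OF U entry _ that] by (intro sum_mono) simp
  then show "Cm_norm_le_mat m A U (real (card {\<beta> :: 'k list. length \<beta> \<le> m}) * (real CARD('k))\<^sup>2 * M)"
    by (simp add: Cm_norm_le_mat_def power2_eq_square mult_ac)
qed

lemma norm_axis_le: "norm (axis i x :: 'b::real_normed_vector^'n) \<le> norm x"
proof -
  have "norm (axis i x :: 'b^'n) \<le> (\<Sum>j\<in>UNIV. norm (axis i x $ j))"
    unfolding norm_vec_def by (rule L2_set_le_sum) simp
  also have "\<dots> = norm x" by (simp add: axis_def if_distrib cong: if_cong)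
  finally show ?thesis .
qed

lemma Ck_bound_vec:
  fixes f :: "'a::euclidean_space \<Rightarrow> 'b::real_normed_vector^'n"
  assumes "\<And>i. Ck_bound m M (\<lambda>u. f u $ i) U"
  shows "Ck_bound m (real CARD('n) * M) f U"
proof -
  have axis: "bounded_linear (axis i :: 'b \<Rightarrow> 'b^'n)" for i
    by (rule bounded_linear_intro[of _ 1]) (auto simp: axis_def vec_eq_iff norm_axis_le[unfolded axis_def])
  have "Ck_bound m (\<Sum>i\<in>(UNIV::'n set). 1 * M) (\<lambda>u. \<Sum>i\<in>UNIV. axis i (f u $ i) :: 'b^'n) U"
    by (intro Ck_bound_sum Ck_bound_linear[OF axis] assms) (auto simp: norm_axis_le)
  moreover have "(\<Sum>i\<in>UNIV. axis i (v $ i)) = v" for v :: "'b^'n"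
    by (auto simp: vec_eq_iff axis_def if_distrib cong: if_cong)
  ultimately show ?thesis by simp
qed

section \<open>Regularity of solutions\<close>

primrec solution_Ck_const :: "real \<Rightarrow> nat \<Rightarrow> real \<Rightarrow> real \<Rightarrow> real" where
  "solution_Ck_const q 0 K M = M / (1 - q)"
| "solution_Ck_const q (Suc m) K M =
    (let N = solution_Ck_const q m K M
     in max N (solution_Ck_const q m 0 (max (2 * K * N + M) (2 ^ m * (M * N) + M))))"

lemma linearised_Ck_bound:
  assumes A: "Ck_bound m N A U" and L: "Ck_bound m M L U"
    and DL: "Ck_bound m M DL U" and DH: "Ck_bound m M DH U"
    and norm_b: "norm b \<le> K" and nonneg: "0 \<le> M" "0 \<le> N"
  shows "Ck_bound m (2 * K * N + M) (\<lambda>u. polar b (A u) + L u) U"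
    and "Ck_bound m (2 ^ m * (M * N) + M) (\<lambda>u. blinfun_apply (DL u) (A u) + DH u) U"
proof -
  have "norm (polar b x) \<le> 2 * K * norm x" for x
    using norm_b by (intro order_trans[OF norm_polar_le] mult_right_mono) auto
  then show "Ck_bound m (2 * K * N + M) (\<lambda>u. polar b (A u) + L u) U"
    using order_trans[OF norm_ge_zero norm_b]
    by (intro Ck_bound_add Ck_bound_linear[OF bounded_linear_polar] A L) auto
  have "Ck_bound m (2 ^ m * (1 * M * N)) (\<lambda>u. blinfun_apply (DL u) (A u)) U"
    by (intro Ck_bound_bilinear[OF bounded_bilinear_blinfun_apply] DL A nonneg) (auto intro: norm_blinfun)
  from Ck_bound_add[OF this DH]
  show "Ck_bound m (2 ^ m * (M * N) + M) (\<lambda>u. blinfun_apply (DL u) (A u) + DH u) U" by simp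
qed

lemma solves_dir_deriv_linearised:
  fixes U :: "'a::euclidean_space set" and L :: "'a \<Rightarrow> 'v::banach \<Rightarrow>\<^sub>L 'v"
  assumes eq: "ray_eq U L H" and sol: "solves_ray_eq U p b L H A" and norm_b: "norm b \<le> K"
    and small: "linearisation_norm_le U b L A q" and q: "q < 1"
    and A: "Ck_bound m N A U" and L: "Ck_bound (Suc m) M L U" and H: "Ck_bound (Suc m) M H U" and e: "e \<in> Basis"
  obtains G L' H' where "has_dir_deriv e A G U" "ray_eq U L' H'" "solves_ray_eq U (Suc p) 0 L' H' G"
    "linearisation_norm_le U 0 L' G q"
    "Ck_bound m (2 * K * N + M) L' U" "Ck_bound m (2 ^ m * (M * N) + M) H' U"
proof -
  interpret ray_eq U b L H by fact
  have "0 \<in> U" using star_U by (simp add: star_at_0_def)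
  then have nonneg: "0 \<le> M" "0 \<le> N"
    using order_trans[OF norm_ge_zero Ck_boundD(2)[OF H]]
      order_trans[OF norm_ge_zero Ck_boundD(2)[OF A]] by auto
  obtain DL where DL: "has_dir_deriv e L DL U" "Ck_bound m M DL U" by (rule Ck_bound_SucE[OF L e])
  obtain DH where DH: "has_dir_deriv e H DH U" "Ck_bound m M DH U" by (rule Ck_bound_SucE[OF H e])
  note linearised = linearised_Ck_bound[OF A Ck_bound_SucD[OF L] DL(2) DH(2) norm_b nonneg]
    and cont = Ck_boundD(1)[OF A] Ck_boundD(1)[OF DL(2)] Ck_boundD(1)[OF DH(2)]
  obtain G where "has_dir_deriv e A G U"
    and "solves_ray_eq U (Suc p) 0 (\<lambda>u. polar b (A u) + L u) (\<lambda>u. DL u (A u) + DH u) G"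
    by (rule solves_dir_deriv_exists[OF sol small q Ck_boundD(2)[OF A] cont(2) DL(1)
          Ck_boundD(2)[OF DL(2)] cont(3) DH(1) Ck_boundD(2)[OF DH(2)]])
  moreover have "linearisation_norm_le U 0 (\<lambda>u. polar b (A u) + L u) G q"
    unfolding linearisation_norm_le_def using norm_linearisation_le[OF small] by simp
  ultimately show thesis using that linearised_ray_eq[OF cont] linearised by blast
qed

lemma solves_Ck_bound:
  assumes "ray_eq U L H" "solves_ray_eq U p b L H A" "norm b \<le> K"
    and "linearisation_norm_le U b L A q" and q: "q < 1"
    and "Ck_bound m M L U" "Ck_bound m M H U"
  shows "Ck_bound m (solution_Ck_const q m K M) A U"
  using assms(1-4,6,7)
proof (induction m arbitrary: p b L H A K M)
  case 0
  interpret ray_eq U b L H by fact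
  show ?case
    using solves_ray_eqD(1)[OF "0.prems"(2)] solves_norm_le_uniform[OF "0.prems"(2,4) q] "0.prems"(6) by simp
next
  case (Suc m)
  define N where "N = solution_Ck_const q m K M"
  define M' where "M' = max (2 * K * N + M) (2 ^ m * (M * N) + M)"
  define N' where "N' = solution_Ck_const q m 0 M'"
  have A: "Ck_bound m N A U"
    unfolding N_def by (rule Suc.IH[OF Suc.prems(1-4) Suc.prems(5,6)[THEN Ck_bound_SucD]])
  have "Ck_bound (Suc m) (max N N') A U"
  proof (rule Ck_bound_SucI)
    show "norm (A u) \<le> max N N'" if "u \<in> U" for u
      using Ck_boundD(2)[OF A that] by (simp add: le_max_iff_disj)
    fix e :: 'a assume e: "e \<in> Basis"
    obtain G L' H' where AG: "has_dir_deriv e A G U" and eq: "ray_eq U L' H'"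
      and G: "solves_ray_eq U (Suc p) 0 L' H' G" and small: "linearisation_norm_le U 0 L' G q"
      and L': "Ck_bound m (2 * K * N + M) L' U" and H': "Ck_bound m (2 ^ m * (M * N) + M) H' U"
      using solves_dir_deriv_linearised[OF Suc.prems(1-4) q A Suc.prems(5,6) e] by blast
    have "Ck_bound m M' L' U" "Ck_bound m M' H' U"
      unfolding M'_def by (rule Ck_bound_mono[OF L'], simp) (rule Ck_bound_mono[OF H'], simp)
    then have "Ck_bound m N' G U"
      unfolding N'_def by (intro Suc.IH[OF eq G _ small]) auto
    from Ck_bound_mono[OF this max.cobounded2]
    show "\<exists>D. has_dir_deriv e A D U \<and> Ck_bound m (max N N') D U" using AG by blast
  qed (rule Ck_boundD(1)[OF A])
  then show ?case by (simp add: N_def N'_def M'_def Let_def)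
qed

section \<open>Gronwall estimates\<close>

lemma first_crossing:
  fixes f g :: "real \<Rightarrow> real"
  assumes cont: "continuous_on {a..b} f" "continuous_on {a..b} g" and start: "f a < g a"
    and t: "t \<in> {a..b}" "g t \<le> f t"
  obtains \<tau> where "a < \<tau>" "\<tau> \<le> b" "g \<tau> \<le> f \<tau>" "\<And>s. a \<le> s \<Longrightarrow> s < \<tau> \<Longrightarrow> f s < g s"
proof -
  define S where "S = {s \<in> {a..b}. g s \<le> f s}"
  have "closed S" unfolding S_def by (intro continuous_on_closed_Collect_le cont) auto
  then have "compact S"
    by (auto simp: compact_eq_bounded_closed S_def intro: bounded_subset[OF bounded_closed_interval])
  moreover have "t \<in> S" using t by (simp add: S_def)
  ultimately obtain \<tau> where \<tau>: "\<tau> \<in> S" "\<And>s. s \<in> S \<Longrightarrow> \<tau> \<le> s"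
    using compact_attains_inf[of S] by auto
  show thesis
  proof
    show "a < \<tau>" using \<tau>(1) start by (cases "\<tau> = a") (auto simp: S_def)
    show "\<tau> \<le> b" "g \<tau> \<le> f \<tau>" using \<tau>(1) by (auto simp: S_def)
    show "f s < g s" if "a \<le> s" "s < \<tau>" for s
      using \<tau>(1) \<tau>(2)[of s] that by (auto simp: S_def not_le[symmetric])
  qed
qed

text \<open>As long as \<open>e\<close> stays below the barrier \<open>\<alpha> exp ((\<beta> + 1) t)\<close>, it moves more slowly than the
  barrier does, and it starts \<open>\<alpha>\<close> below it.\<close>

lemma gronwall_barrier:
  fixes e :: "real \<Rightarrow> 'a::real_normed_vector"
  assumes cont: "continuous_on {0..T} e" and e0: "e 0 = 0"
    and deriv: "\<And>t. 0 < t \<Longrightarrow> t < T \<Longrightarrow> (e has_vector_derivative e' t) (at t)"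
    and bound: "\<And>t. 0 < t \<Longrightarrow> t < T \<Longrightarrow> norm (e t) < \<alpha> * exp ((\<beta> + 1) * t) \<Longrightarrow> norm (e' t) \<le> \<alpha> + \<beta> * norm (e t)"
    and \<alpha>: "0 < \<alpha>" and \<beta>: "0 \<le> \<beta>" and t: "t \<in> {0..T}"
  shows "norm (e t) < \<alpha> * exp ((\<beta> + 1) * t)"
proof (rule ccontr)
  define \<Lambda> where "\<Lambda> t = \<alpha> * exp ((\<beta> + 1) * t)" for t
  have cont_\<Lambda>: "continuous_on S \<Lambda>" for S unfolding \<Lambda>_def by (intro continuous_intros)
  have \<Lambda>0: "\<Lambda> 0 = \<alpha>" by (simp add: \<Lambda>_def)
  assume "\<not> norm (e t) < \<alpha> * exp ((\<beta> + 1) * t)"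
  then have crossed: "\<Lambda> t \<le> norm (e t)" by (simp add: \<Lambda>_def)
  obtain \<tau> where \<tau>: "0 < \<tau>" "\<tau> \<le> T" "\<Lambda> \<tau> \<le> norm (e \<tau>)" and below: "\<And>s. 0 \<le> s \<Longrightarrow> s < \<tau> \<Longrightarrow> norm (e s) < \<Lambda> s"
    by (rule first_crossing[OF continuous_on_norm[OF cont] cont_\<Lambda> _ t crossed]) (use \<alpha> e0 \<Lambda>0 in auto)
  have "norm (e \<tau> - e 0) \<le> \<Lambda> \<tau> - \<Lambda> 0"
  proof (rule differentiable_bound_general[OF \<tau>(1), where f' = e' and \<phi>' = "\<lambda>s. (\<beta> + 1) * \<Lambda> s"])
    show "continuous_on {0..\<tau>} e" using cont \<tau>(2) by (auto intro: continuous_on_subset)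
    fix s assume s: "0 < s" "s < \<tau>"
    show "(e has_vector_derivative e' s) (at s)" using deriv s \<tau>(2) by auto
    show "(\<Lambda> has_vector_derivative (\<beta> + 1) * \<Lambda> s) (at s)"
      unfolding \<Lambda>_def has_real_derivative_iff_has_vector_derivative[symmetric]
      by (auto intro!: derivative_eq_intros)
    have "norm (e' s) \<le> \<alpha> + \<beta> * norm (e s)"
      using bound[of s] below[of s] s \<tau>(2) by (auto simp: \<Lambda>_def)
    also have "\<dots> \<le> \<Lambda> s + \<beta> * \<Lambda> s"
    proof (intro add_mono mult_left_mono \<beta>)
      show "\<alpha> \<le> \<Lambda> s" using \<alpha> \<beta> s by (simp add: \<Lambda>_def)
      show "norm (e s) \<le> \<Lambda> s" using below[of s] s by simp
    qed
    finally show "norm (e' s) \<le> (\<beta> + 1) * \<Lambda> s" by (simp add: algebra_simps)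
  qed (rule cont_\<Lambda>)
  then show False using \<tau>(3) \<Lambda>0 \<alpha> e0 by simp
qed

lemma gronwall_eq_0:
  fixes e :: "real \<Rightarrow> 'a::real_normed_vector"
  assumes cont: "continuous_on {0..T} e" and e0: "e 0 = 0"
    and deriv: "\<And>t. 0 < t \<Longrightarrow> t < T \<Longrightarrow> (e has_vector_derivative e' t) (at t)"
    and bound: "\<And>t. 0 < t \<Longrightarrow> t < T \<Longrightarrow> norm (e' t) \<le> \<beta> * norm (e t)"
    and \<beta>: "0 \<le> \<beta>" and t: "t \<in> {0..T}"
  shows "e t = 0"
proof (rule ccontr)
  define \<alpha> where "\<alpha> = norm (e t) / exp ((\<beta> + 1) * t)"
  assume "e t \<noteq> 0"
  then have \<alpha>: "0 < \<alpha>" by (simp add: \<alpha>_def)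
  have "norm (e t) < \<alpha> * exp ((\<beta> + 1) * t)"
    by (rule gronwall_barrier[OF cont e0 deriv _ \<alpha> \<beta> t])
       (use bound \<alpha> in \<open>auto intro: add_increasing[OF less_imp_le]\<close>)
  then show False by (simp add: \<alpha>_def)
qed

section \<open>The exponential map\<close>

definition integral_curve :: "('a::real_normed_vector \<Rightarrow> 'a) \<Rightarrow> 'a set \<Rightarrow> 'a \<Rightarrow> (real \<Rightarrow> 'a) \<Rightarrow> bool" where
  "integral_curve F \<Omega> x0 \<gamma> \<longleftrightarrow> \<gamma> 0 = x0 \<and> \<gamma> ` {0..1} \<subseteq> \<Omega> \<and>
    (\<forall>t\<in>{0..1}. (\<gamma> has_vector_derivative F (\<gamma> t)) (at t within {0..1}))"

lemma integral_curveD: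
  assumes "integral_curve F \<Omega> x0 \<gamma>"
  shows "\<gamma> 0 = x0" "\<gamma> ` {0..1} \<subseteq> \<Omega>" "continuous_on {0..1} \<gamma>"
    and "0 < t \<Longrightarrow> t < 1 \<Longrightarrow> (\<gamma> has_vector_derivative F (\<gamma> t)) (at t)"
proof -
  have deriv: "(\<gamma> has_vector_derivative F (\<gamma> t)) (at t within {0..1})" if "t \<in> {0..1}" for t
    using assms that by (simp add: integral_curve_def)
  show "\<gamma> 0 = x0" "\<gamma> ` {0..1} \<subseteq> \<Omega>" using assms by (simp_all add: integral_curve_def)
  show "continuous_on {0..1} \<gamma>" by (rule continuous_on_vector_derivative[OF deriv])
  show "(\<gamma> has_vector_derivative F (\<gamma> t)) (at t)" if "0 < t" "t < 1"
    using deriv[of t] that at_within_interior[of t "{0..1}"] by simp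
qed

lemma integral_curve_of_integral_equation:
  fixes F :: "'a::banach \<Rightarrow> 'a"
  assumes F: "continuous_on \<Omega> F" and \<Omega>: "\<gamma> ` {0..1} \<subseteq> \<Omega>"
    and int: "\<And>t. t \<in> {0..1} \<Longrightarrow> ((\<lambda>s. F (\<gamma> s)) has_integral (\<gamma> t - x0)) {0..t}"
  shows "integral_curve F \<Omega> x0 \<gamma>"
proof -
  have \<gamma>_eq: "\<gamma> t = x0 + integral {0..t} (\<lambda>s. F (\<gamma> s))" if "t \<in> {0..1}" for t
    using integral_unique[OF int[OF that]] by simp
  have "continuous_on {0..1} (\<lambda>t. x0 + integral {0..t} (\<lambda>s. F (\<gamma> s)))"
    using int[of 1] by (intro continuous_intros indefinite_integral_continuous_1) auto
  then have "continuous_on {0..1} \<gamma>" by (rule continuous_on_eq) (simp add: \<gamma>_eq)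
  then have cont: "continuous_on {0..1} (\<lambda>s. F (\<gamma> s))"
    by (rule continuous_on_compose2[OF F _ \<Omega>])
  have "(\<gamma> has_vector_derivative F (\<gamma> t)) (at t within {0..1})" if t: "t \<in> {0..1}" for t
  proof (rule has_vector_derivative_transform[OF t])
    show "((\<lambda>t. x0 + integral {0..t} (\<lambda>s. F (\<gamma> s))) has_vector_derivative F (\<gamma> t)) (at t within {0..1})"
      using has_vector_derivative_add[OF has_vector_derivative_const
            integral_has_vector_derivative[OF cont t], of x0]
      by simp
  qed (simp add: \<gamma>_eq)
  then show ?thesis using \<gamma>_eq[of 0] \<Omega> by (simp add: integral_curve_def)
qed

lemma integral_curve_perturbation:
  fixes \<gamma> \<gamma>' :: "real \<Rightarrow> 'a::real_normed_vector"
  assumes \<gamma>: "integral_curve F \<Omega> x0 \<gamma>" and \<gamma>': "integral_curve G \<Omega>' x0 \<gamma>'"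
    and close: "\<And>t y. t \<in> {0..1} \<Longrightarrow> norm (y - \<gamma> t) \<le> \<delta> \<Longrightarrow> norm (G y - F (\<gamma> t)) \<le> \<alpha> + \<beta> * norm (y - \<gamma> t)"
    and \<alpha>: "0 < \<alpha>" "\<alpha> * exp (\<beta> + 1) \<le> \<delta>" and \<beta>: "0 \<le> \<beta>"
  shows "norm (\<gamma>' 1 - \<gamma> 1) < \<alpha> * exp (\<beta> + 1)"
proof -
  have "norm (\<gamma>' 1 - \<gamma> 1) < \<alpha> * exp ((\<beta> + 1) * 1)"
  proof (rule gronwall_barrier[where T = 1 and e = "\<lambda>t. \<gamma>' t - \<gamma> t" and e' = "\<lambda>t. G (\<gamma>' t) - F (\<gamma> t)"])
    show "continuous_on {0..1} (\<lambda>t. \<gamma>' t - \<gamma> t)"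
      by (intro continuous_on_diff integral_curveD(3)[OF \<gamma>] integral_curveD(3)[OF \<gamma>'])
    fix t :: real assume t: "0 < t" "t < 1"
    show "((\<lambda>t. \<gamma>' t - \<gamma> t) has_vector_derivative G (\<gamma>' t) - F (\<gamma> t)) (at t)"
      by (intro has_vector_derivative_diff integral_curveD(4)[OF \<gamma>] integral_curveD(4)[OF \<gamma>'] t)
    assume "norm (\<gamma>' t - \<gamma> t) < \<alpha> * exp ((\<beta> + 1) * t)"
    also have "\<dots> \<le> \<alpha> * exp (\<beta> + 1)" using \<alpha> \<beta> t by (simp add: mult_left_le)
    finally show "norm (G (\<gamma>' t) - F (\<gamma> t)) \<le> \<alpha> + \<beta> * norm (\<gamma>' t - \<gamma> t)"
      using \<alpha>(2) t by (intro close) auto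
  qed (use \<alpha> \<beta> integral_curveD(1)[OF \<gamma>] integral_curveD(1)[OF \<gamma>'] in auto)
  then show ?thesis by simp
qed

definition C1_on :: "'a set \<Rightarrow> ('a::real_normed_vector \<Rightarrow> 'b::real_normed_vector) \<Rightarrow> bool" where
  "C1_on S f \<longleftrightarrow> (\<forall>x\<in>S. f differentiable (at x)) \<and> continuous_on S (\<lambda>x. frechet_derivative f (at x))"

lemma C1_onD:
  assumes "C1_on S f"
  shows "x \<in> S \<Longrightarrow> (f has_derivative frechet_derivative f (at x)) (at x)"
    and "continuous_on S f" and "continuous_on S (\<lambda>x. frechet_derivative f (at x))"
  using assms unfolding C1_on_def frechet_derivative_works[symmetric]
  by (auto intro: continuous_at_imp_continuous_on differentiable_imp_continuous_within)

text \<open>Continuity of \<open>f'\<close> refers to the product topology, that is pointwise convergence, which in finite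
  dimension suffices to bound the operator norms.\<close>

lemma onorm_bounded_on_compact:
  fixes f' :: "'a::topological_space \<Rightarrow> 'b::euclidean_space \<Rightarrow> 'c::real_normed_vector"
  assumes "compact S" "continuous_on S f'" "\<And>x. x \<in> S \<Longrightarrow> bounded_linear (f' x)"
  obtains M where "\<And>x. x \<in> S \<Longrightarrow> onorm (f' x) \<le> M"
proof -
  have "\<exists>N. \<forall>x\<in>S. norm (f' x v) \<le> N" for v
    using compact_imp_bounded[OF compact_continuous_image[OF
          continuous_on_product_then_coordinatewise[OF assms(2)] assms(1)], of v]
    by (auto simp: bounded_iff)
  then obtain N where N: "\<And>v x. x \<in> S \<Longrightarrow> norm (f' x v) \<le> N v" by metis
  show thesis
    by (rule that[of "\<Sum>v\<in>Basis. N v"])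
       (intro order_trans[OF onorm_componentwise] assms(3) sum_mono N)
qed

lemma C1_on_lipschitz_near_compact:
  fixes f :: "'a::euclidean_space \<Rightarrow> 'b::real_normed_vector"
  assumes f: "C1_on \<Omega> f" and \<Omega>: "open \<Omega>" and S: "compact S" "S \<subseteq> \<Omega>"
  obtains \<delta> M where "\<delta> > 0" "M > 0" "\<And>x. x \<in> S \<Longrightarrow> norm (f x) \<le> M"
    "\<And>x y. x \<in> S \<Longrightarrow> norm (y - x) \<le> \<delta> \<Longrightarrow> norm (f y - f x) \<le> M * norm (y - x)"
proof -
  obtain \<delta> where \<delta>: "\<delta> > 0" "(\<Union>x\<in>S. cball x \<delta>) \<subseteq> \<Omega>"
    using compact_subset_open_imp_cball_epsilon_subset[OF S(1) \<Omega> S(2)] .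
  let ?T = "\<Union>x\<in>S. cball x \<delta>"
  obtain M' where M': "\<And>x. x \<in> ?T \<Longrightarrow> onorm (frechet_derivative f (at x)) \<le> M'"
  proof (rule onorm_bounded_on_compact)
    show "compact ?T" by (rule compact_minkowski_sum_cball[OF S(1)])
    show "continuous_on ?T (\<lambda>x. frechet_derivative f (at x))"
      by (rule continuous_on_subset[OF C1_onD(3)[OF f] \<delta>(2)])
    show "bounded_linear (frechet_derivative f (at x))" if "x \<in> ?T" for x
      using C1_onD(1)[OF f subsetD[OF \<delta>(2) that]] by (rule has_derivative_bounded_linear)
  qed blast
  have "bounded (f ` S)"
    by (intro compact_imp_bounded compact_continuous_image continuous_on_subset[OF C1_onD(2)[OF f]] S)
  then obtain M where M: "M > 0" "\<And>x. x \<in> S \<Longrightarrow> norm (f x) \<le> M" by (auto simp: bounded_pos)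
  have lipschitz: "norm (f y - f x) \<le> M' * norm (y - x)" if x: "x \<in> S" and y: "norm (y - x) \<le> \<delta>" for x y
  proof (rule differentiable_bound[OF convex_cball[of x \<delta>]])
    fix z assume z: "z \<in> cball x \<delta>"
    then have "z \<in> ?T" using x by blast
    then show "onorm (frechet_derivative f (at z)) \<le> M'" by (rule M')
    show "(f has_derivative frechet_derivative f (at z)) (at z within cball x \<delta>)"
      using C1_onD(1)[OF f subsetD[OF \<delta>(2) \<open>z \<in> ?T\<close>]] by (rule has_derivative_at_withinI)
  qed (use y \<delta>(1) in \<open>auto simp: dist_norm norm_minus_commute\<close>)
  show thesis
  proof (rule that[of \<delta> "max M M'"])
    show "norm (f y - f x) \<le> max M M' * norm (y - x)" if "x \<in> S" "norm (y - x) \<le> \<delta>" for x y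
      by (rule order_trans[OF lipschitz[OF that]]) (intro mult_right_mono, simp_all)
  qed (use \<delta> M in \<open>auto simp: le_max_iff_disj less_max_iff_disj\<close>)
qed

definition lincomb :: "('k::finite \<Rightarrow> 'a \<Rightarrow> 'b::real_vector) \<Rightarrow> real^'k \<Rightarrow> 'a \<Rightarrow> 'b" where
  "lincomb X u x = (\<Sum>j\<in>UNIV. u $ j *\<^sub>R X j x)"

lemma lincomb_diff: "lincomb X v y - lincomb X u x
    = (\<Sum>j\<in>UNIV. (v - u) $ j *\<^sub>R X j x + v $ j *\<^sub>R (X j y - X j x))"
  by (simp add: lincomb_def algebra_simps flip: sum_subtractf)

lemma lincomb_lipschitz_near_compact:
  fixes X :: "'k::finite \<Rightarrow> 'a::euclidean_space \<Rightarrow> 'b::real_normed_vector"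
  assumes X: "\<forall>j. C1_on \<Omega> (X j)" and \<Omega>: "open \<Omega>" and S: "compact S" "S \<subseteq> \<Omega>"
  obtains \<delta> M where "\<delta> > 0" "M > 0"
    "\<And>u v x y. x \<in> S \<Longrightarrow> norm (y - x) \<le> \<delta> \<Longrightarrow>
      norm (lincomb X v y - lincomb X u x) \<le> M * norm (v - u) + M * norm v * norm (y - x)"
proof -
  have "\<exists>\<delta> M. \<delta> > 0 \<and> M > 0 \<and> (\<forall>x\<in>S. norm (X j x) \<le> M) \<and>
      (\<forall>x\<in>S. \<forall>y. norm (y - x) \<le> \<delta> \<longrightarrow> norm (X j y - X j x) \<le> M * norm (y - x))" for j
    by (rule C1_on_lipschitz_near_compact[OF spec[OF X, of j] \<Omega> S]) blast
  then obtain \<delta> M where pos: "\<And>j. \<delta> j > 0" "\<And>j. M j > 0" and X_le: "\<And>j x. x \<in> S \<Longrightarrow> norm (X j x) \<le> M j"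
    and X_diff_le: "\<And>j x y. x \<in> S \<Longrightarrow> norm (y - x) \<le> \<delta> j \<Longrightarrow> norm (X j y - X j x) \<le> M j * norm (y - x)"
    by metis
  show thesis
  proof (rule that[of "Min (range \<delta>)" "sum M UNIV"])
    show "Min (range \<delta>) > 0" "sum M UNIV > 0" using pos by (auto intro: sum_pos)
    fix u v x y assume x: "x \<in> S" and y: "norm (y - x) \<le> Min (range \<delta>)"
    have "norm (lincomb X v y - lincomb X u x) \<le> (\<Sum>j\<in>UNIV. norm (v - u) * M j + norm v * (M j * norm (y - x)))"
      unfolding lincomb_diff
    proof (rule order_trans[OF norm_sum sum_mono], intro norm_triangle_mono)
      fix j
      show "norm ((v - u) $ j *\<^sub>R X j x) \<le> norm (v - u) * M j"
        unfolding norm_scaleR using component_le_norm_cart[of "v - u" j] X_le[OF x, of j]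
        by (intro mult_mono) auto
      have "norm (X j y - X j x) \<le> M j * norm (y - x)" using y by (intro X_diff_le x) simp
      then show "norm (v $ j *\<^sub>R (X j y - X j x)) \<le> norm v * (M j * norm (y - x))"
        unfolding norm_scaleR using component_le_norm_cart[of v j] by (intro mult_mono) auto
    qed
    also have "\<dots> = sum M UNIV * norm (v - u) + sum M UNIV * norm v * norm (y - x)"
      by (simp add: sum.distrib sum_distrib_left sum_distrib_right mult_ac)
    finally show "norm (lincomb X v y - lincomb X u x)
      \<le> sum M UNIV * norm (v - u) + sum M UNIV * norm v * norm (y - x)" .
  qed
qed

lemma integral_curve_lincomb_stable:
  fixes X :: "'k::finite \<Rightarrow> 'a::euclidean_space \<Rightarrow> 'a"
  assumes X: "\<forall>j. C1_on \<Omega> (X j)" and \<Omega>: "open \<Omega>" and \<gamma>: "integral_curve (lincomb X u) \<Omega> x0 \<gamma>" and \<epsilon>: "\<epsilon> > 0"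
  obtains \<rho> where "\<rho> > 0"
    "\<And>v \<gamma>'. integral_curve (lincomb X v) \<Omega> x0 \<gamma>' \<Longrightarrow> norm (v - u) < \<rho> \<Longrightarrow> norm (\<gamma>' 1 - \<gamma> 1) < \<epsilon>"
proof -
  have "compact (\<gamma> ` {0..1})" by (intro compact_continuous_image integral_curveD(3)[OF \<gamma>] compact_Icc)
  then obtain \<delta> M where \<delta>: "\<delta> > 0" and M: "M > 0"
    and lipschitz: "\<And>v x y. x \<in> \<gamma> ` {0..1} \<Longrightarrow> norm (y - x) \<le> \<delta> \<Longrightarrow>
      norm (lincomb X v y - lincomb X u x) \<le> M * norm (v - u) + M * norm v * norm (y - x)"
    by (rule lincomb_lipschitz_near_compact[OF X \<Omega> _ integral_curveD(2)[OF \<gamma>]]) blast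
  define \<beta> where "\<beta> = M * (norm u + 1)"
  define \<alpha> where "\<alpha> = min \<delta> \<epsilon> / exp (\<beta> + 1)"
  have \<alpha>: "\<alpha> > 0" using \<delta> \<epsilon> by (simp add: \<alpha>_def)
  show thesis
  proof (rule that[of "min 1 (\<alpha> / M)"])
    show "min 1 (\<alpha> / M) > 0" using \<alpha> M by simp
    fix v \<gamma>' assume \<gamma>': "integral_curve (lincomb X v) \<Omega> x0 \<gamma>'" and v: "norm (v - u) < min 1 (\<alpha> / M)"
    have "norm (\<gamma>' 1 - \<gamma> 1) < \<alpha> * exp (\<beta> + 1)"
    proof (rule integral_curve_perturbation[OF \<gamma> \<gamma>' _ \<alpha>])
      fix t y assume t: "t \<in> {0..1::real}" and y: "norm (y - \<gamma> t) \<le> \<delta>"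
      have "norm (lincomb X v y - lincomb X u (\<gamma> t)) \<le> M * norm (v - u) + M * norm v * norm (y - \<gamma> t)"
        using t y by (intro lipschitz) auto
      also have "M * norm (v - u) \<le> \<alpha>" using v M by (simp add: pos_less_divide_eq mult.commute)
      also have "M * norm v \<le> \<beta>"
        unfolding \<beta>_def using v M norm_triangle_sub[of v u] by (intro mult_left_mono) auto
      finally show "norm (lincomb X v y - lincomb X u (\<gamma> t)) \<le> \<alpha> + \<beta> * norm (y - \<gamma> t)"
        by (simp add: mult_right_mono)
    qed (use M in \<open>auto simp: \<alpha>_def \<beta>_def\<close>)
    also have "\<dots> \<le> \<epsilon>" by (simp add: \<alpha>_def)
    finally show "norm (\<gamma>' 1 - \<gamma> 1) < \<epsilon>" .
  qed
qed

lemma Phi_eq: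
  assumes X: "\<forall>j. C1_on \<Omega> (X j)" and \<Omega>: "open \<Omega>" and \<gamma>: "integral_curve (lincomb X u) \<Omega> x0 \<gamma>"
  shows "Phi \<Omega> X x0 u = \<gamma> 1"
proof -
  have unique: "\<gamma>' 1 = \<gamma> 1" if \<gamma>': "integral_curve (lincomb X u) \<Omega> x0 \<gamma>'" for \<gamma>'
  proof (rule ccontr)
    assume "\<gamma>' 1 \<noteq> \<gamma> 1"
    then have "0 < norm (\<gamma>' 1 - \<gamma> 1)" by simp
    from integral_curve_lincomb_stable[OF X \<Omega> \<gamma> this] obtain \<rho> where "\<rho> > 0"
      "\<And>v \<gamma>''. integral_curve (lincomb X v) \<Omega> x0 \<gamma>'' \<Longrightarrow> norm (v - u) < \<rho> \<Longrightarrow>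
        norm (\<gamma>'' 1 - \<gamma> 1) < norm (\<gamma>' 1 - \<gamma> 1)"
      by blast
    from this(2)[OF \<gamma>'] this(1) show False by simp
  qed
  have "Phi \<Omega> X x0 u = (THE y. \<exists>\<gamma>. integral_curve (lincomb X u) \<Omega> x0 \<gamma> \<and> y = \<gamma> 1)"
    unfolding Phi_def integral_curve_def lincomb_def by (rule arg_cong[where f = The]) blast
  also have "\<dots> = \<gamma> 1" using \<gamma> unique by (intro the_equality) blast+
  finally show ?thesis .
qed

lemma continuous_on_Phi:
  assumes X: "\<forall>j. C1_on \<Omega> (X j)" and \<Omega>: "open \<Omega>"
    and ex: "\<And>u. u \<in> V \<Longrightarrow> \<exists>\<gamma>. integral_curve (lincomb X u) \<Omega> x0 \<gamma>"
  shows "continuous_on V (Phi \<Omega> X x0)"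
  unfolding continuous_on_iff
proof (intro ballI allI impI)
  fix u \<epsilon> assume u: "u \<in> V" and \<epsilon>: "(0::real) < \<epsilon>"
  obtain \<gamma> where \<gamma>: "integral_curve (lincomb X u) \<Omega> x0 \<gamma>" using ex[OF u] by blast
  obtain \<rho> where \<rho>: "\<rho> > 0"
    "\<And>v \<gamma>'. integral_curve (lincomb X v) \<Omega> x0 \<gamma>' \<Longrightarrow> norm (v - u) < \<rho> \<Longrightarrow> norm (\<gamma>' 1 - \<gamma> 1) < \<epsilon>"
    using integral_curve_lincomb_stable[OF X \<Omega> \<gamma> \<epsilon>] by blast
  have "dist (Phi \<Omega> X x0 v) (Phi \<Omega> X x0 u) < \<epsilon>" if v: "v \<in> V" "dist v u < \<rho>" for v
  proof -
    obtain \<gamma>' where \<gamma>': "integral_curve (lincomb X v) \<Omega> x0 \<gamma>'" using ex[OF v(1)] by blast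
    show ?thesis
      using \<rho>(2)[OF \<gamma>'] v(2) unfolding Phi_eq[OF X \<Omega> \<gamma>] Phi_eq[OF X \<Omega> \<gamma>'] dist_norm by simp
  qed
  then show "\<exists>d>0. \<forall>v\<in>V. dist v u < d \<longrightarrow> dist (Phi \<Omega> X x0 v) (Phi \<Omega> X x0 u) < \<epsilon>"
    using \<rho>(1) by blast
qed

section \<open>Radial solutions\<close>

definition radial_solution ::
  "real \<Rightarrow> (('a::real_normed_vector \<Rightarrow> 'v::real_normed_vector) \<Rightarrow> 'a \<Rightarrow> 'v) \<Rightarrow> ('a \<Rightarrow> 'v) \<Rightarrow> bool" where
  "radial_solution \<eta> R A \<longleftrightarrow> continuous_on (ball 0 \<eta>) A \<and>
    (\<forall>\<omega>. norm \<omega> = 1 \<longrightarrow>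
      (\<forall>r\<in>{0<..<\<eta>}. ((\<lambda>s. s *\<^sub>R A (s *\<^sub>R \<omega>)) has_vector_derivative R A (r *\<^sub>R \<omega>)) (at r)) \<and>
      (\<exists>K \<delta>. \<delta> > 0 \<and> (\<forall>r\<in>{0<..<\<delta>}. norm (A (r *\<^sub>R \<omega>)) \<le> K * r)))"

lemma radial_solutionD:
  assumes "radial_solution \<eta> R A" "norm \<omega> = 1"
  shows "0 < r \<Longrightarrow> r < \<eta> \<Longrightarrow> ((\<lambda>s. s *\<^sub>R A (s *\<^sub>R \<omega>)) has_vector_derivative R A (r *\<^sub>R \<omega>)) (at r)"
    and "T < \<eta> \<Longrightarrow> continuous_on {0..T} (\<lambda>r. A (r *\<^sub>R \<omega>))"
proof -
  show "0 < r \<Longrightarrow> r < \<eta> \<Longrightarrow> ((\<lambda>s. s *\<^sub>R A (s *\<^sub>R \<omega>)) has_vector_derivative R A (r *\<^sub>R \<omega>)) (at r)"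
    using assms by (simp add: radial_solution_def)
  show "continuous_on {0..T} (\<lambda>r. A (r *\<^sub>R \<omega>))" if "T < \<eta>"
    by (rule continuous_on_compose2[of "ball 0 \<eta>" A])
       (use assms that in \<open>auto simp: radial_solution_def intro!: continuous_intros\<close>)
qed

lemma radial_solution_norm_le:
  assumes sol: "radial_solution \<eta> R A" and \<omega>: "norm \<omega> = 1" and T: "0 < T" "T < \<eta>"
  obtains N where "0 \<le> N" "\<And>r. 0 < r \<Longrightarrow> r \<le> T \<Longrightarrow> norm (A (r *\<^sub>R \<omega>)) \<le> N * r"
proof -
  obtain K \<delta> where K: "\<delta> > 0" "\<And>r. r \<in> {0<..<\<delta>} \<Longrightarrow> norm (A (r *\<^sub>R \<omega>)) \<le> K * r"
    using sol \<omega> unfolding radial_solution_def by metis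
  have "bounded ((\<lambda>r. A (r *\<^sub>R \<omega>)) ` {0..T})"
    by (intro compact_imp_bounded compact_continuous_image radial_solutionD(2)[OF sol \<omega> T(2)] compact_Icc)
  then obtain S where S: "S > 0" "\<And>r. r \<in> {0..T} \<Longrightarrow> norm (A (r *\<^sub>R \<omega>)) \<le> S"
    unfolding bounded_pos by blast
  show thesis
  proof (rule that[of "max K (S / \<delta>)"])
    show "0 \<le> max K (S / \<delta>)" using S(1) K(1) by (simp add: le_max_iff_disj)
    fix r assume r: "0 < r" "r \<le> T"
    show "norm (A (r *\<^sub>R \<omega>)) \<le> max K (S / \<delta>) * r"
    proof (cases "r < \<delta>")
      case True
      then have "norm (A (r *\<^sub>R \<omega>)) \<le> K * r" using K(2) r by simp
      also have "\<dots> \<le> max K (S / \<delta>) * r" using r by (intro mult_right_mono) auto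
      finally show ?thesis .
    next
      case False
      have "norm (A (r *\<^sub>R \<omega>)) \<le> S" using S(2) r by auto
      also have "S \<le> (S / \<delta>) * r" using False S(1) K(1) by (simp add: pos_le_divide_eq mult_left_mono)
      also have "\<dots> \<le> max K (S / \<delta>) * r" using r by (intro mult_right_mono) auto
      finally show ?thesis .
    qed
  qed
qed

lemma radial_solution_at_0:
  fixes A :: "'a::real_normed_vector \<Rightarrow> 'v::real_normed_vector" and \<omega> :: 'a
  assumes sol: "radial_solution \<eta> R A" and \<omega>: "norm \<omega> = 1" and \<eta>: "0 < \<eta>"
  shows "A 0 = 0"
proof -
  obtain K \<delta> where K: "\<delta> > 0" "\<And>r. r \<in> {0<..<\<delta>} \<Longrightarrow> norm (A (r *\<^sub>R \<omega>)) \<le> K * r"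
    using sol \<omega> unfolding radial_solution_def by metis
  have "continuous_on {0..\<eta> / 2} (\<lambda>r. A (r *\<^sub>R \<omega>))" using \<eta> by (intro radial_solutionD(2)[OF sol \<omega>]) simp
  then have "((\<lambda>r. A (r *\<^sub>R \<omega>)) \<longlongrightarrow> A 0) (at_right 0)"
    using \<eta> at_within_Icc_at_right[of 0 "\<eta> / 2"] by (force simp: continuous_on_def)
  moreover have "((\<lambda>r. A (r *\<^sub>R \<omega>)) \<longlongrightarrow> 0) (at_right 0)"
  proof (rule Lim_null_comparison)
    show "\<forall>\<^sub>F r in at_right 0. norm (A (r *\<^sub>R \<omega>)) \<le> K * r"
      by (rule eventually_at_rightI[OF _ K(1)]) (rule K(2))
    show "((*) K \<longlongrightarrow> 0) (at_right 0)" by (auto intro!: tendsto_eq_intros)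
  qed
  ultimately show ?thesis by (rule tendsto_unique[OF trivial_limit_at_right_real])
qed

text \<open>For two solutions \<open>A\<close>, \<open>A'\<close> the function \<open>r (A' - A)\<close> solves a linear equation along each ray.
  Its coefficients \<open>A / r\<close>, \<open>A' / r\<close> and \<open>L / r\<close> are bounded because of the decay condition at the origin.\<close>

lemma radial_solution_unique_on_ray:
  fixes \<omega> :: "'a::real_normed_vector"
  assumes A: "radial_solution \<eta> (quad_rhs b L H) A" and A': "radial_solution \<eta> (quad_rhs b L H) A'"
    and L: "\<And>u. u \<in> ball 0 \<eta> \<Longrightarrow> norm (L u) \<le> l * norm u" and l: "0 \<le> l"
    and \<omega>: "norm \<omega> = 1" and T: "0 < T" "T < \<eta>"
  shows "A' (T *\<^sub>R \<omega>) = A (T *\<^sub>R \<omega>)"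
proof -
  obtain N where N: "0 \<le> N" "\<And>r. 0 < r \<Longrightarrow> r \<le> T \<Longrightarrow> norm (A (r *\<^sub>R \<omega>)) \<le> N * r"
    using radial_solution_norm_le[OF A \<omega> T] by blast
  obtain N' where N': "0 \<le> N'" "\<And>r. 0 < r \<Longrightarrow> r \<le> T \<Longrightarrow> norm (A' (r *\<^sub>R \<omega>)) \<le> N' * r"
    using radial_solution_norm_le[OF A' \<omega> T] by blast
  let ?rhs = "quad_rhs b L H" and ?\<beta> = "norm b * (N' + N) + l"
  have "T *\<^sub>R (A' (T *\<^sub>R \<omega>) - A (T *\<^sub>R \<omega>)) = 0"
  proof (rule gronwall_eq_0[where e' = "\<lambda>r. ?rhs A' (r *\<^sub>R \<omega>) - ?rhs A (r *\<^sub>R \<omega>)" and \<beta> = ?\<beta>])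
    show "continuous_on {0..T} (\<lambda>r. r *\<^sub>R (A' (r *\<^sub>R \<omega>) - A (r *\<^sub>R \<omega>)))"
      by (intro continuous_intros radial_solutionD(2)[OF A \<omega> T(2)] radial_solutionD(2)[OF A' \<omega> T(2)])
    fix r assume r: "0 < r" "r < T"
    then have r_lt_\<eta>: "r < \<eta>" using T by simp
    show "((\<lambda>r. r *\<^sub>R (A' (r *\<^sub>R \<omega>) - A (r *\<^sub>R \<omega>))) has_vector_derivative
        ?rhs A' (r *\<^sub>R \<omega>) - ?rhs A (r *\<^sub>R \<omega>)) (at r)"
      unfolding scaleR_diff_right
      by (intro has_vector_derivative_diff radial_solutionD(1)[OF A \<omega>] radial_solutionD(1)[OF A' \<omega>] r r_lt_\<eta>)
    have "norm (L (r *\<^sub>R \<omega>)) \<le> l * r" using L[of "r *\<^sub>R \<omega>"] r r_lt_\<eta> \<omega> by simp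
    then have "norm b * (norm (A' (r *\<^sub>R \<omega>)) + norm (A (r *\<^sub>R \<omega>))) + norm (L (r *\<^sub>R \<omega>))
      \<le> norm b * (N' * r + N * r) + l * r"
      using N(2)[of r] N'(2)[of r] r by (intro add_mono mult_left_mono) auto
    also have "\<dots> = ?\<beta> * r" by (simp add: algebra_simps)
    finally have "norm (?rhs A' (r *\<^sub>R \<omega>) - ?rhs A (r *\<^sub>R \<omega>)) \<le> ?\<beta> * r * norm (A' (r *\<^sub>R \<omega>) - A (r *\<^sub>R \<omega>))"
      by (intro order_trans[OF norm_quad_rhs_diff_le] mult_right_mono) auto
    then show "norm (?rhs A' (r *\<^sub>R \<omega>) - ?rhs A (r *\<^sub>R \<omega>)) \<le> ?\<beta> * norm (r *\<^sub>R (A' (r *\<^sub>R \<omega>) - A (r *\<^sub>R \<omega>)))"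
      using r by simp
  qed (use N(1) N'(1) l T in auto)
  then show ?thesis using T by simp
qed

lemma radial_solution_unique:
  fixes A A' :: "'a::{real_normed_vector, perfect_space} \<Rightarrow> 'v::real_normed_vector"
  assumes A: "radial_solution \<eta> (quad_rhs b L H) A" and A': "radial_solution \<eta> (quad_rhs b L H) A'"
    and L: "\<And>u. u \<in> ball 0 \<eta> \<Longrightarrow> norm (L u) \<le> l * norm u" and l: "0 \<le> l" and u: "u \<in> ball 0 \<eta>"
  shows "A' u = A u"
proof (cases "u = 0")
  case True
  obtain \<omega> :: 'a where \<omega>: "norm \<omega> = 1" using vector_choose_size[of 1] by auto
  have "0 < \<eta>" using u True by simp
  then show ?thesis using True radial_solution_at_0[OF A \<omega>] radial_solution_at_0[OF A' \<omega>] by simp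
next
  case False
  then show ?thesis
    using radial_solution_unique_on_ray[OF A A' L l, of "u /\<^sub>R norm u" "norm u"] u by simp
qed

lemma solves_ray_eq_imp_radial_solution:
  assumes "ray_eq (ball 0 \<eta>) L H" and sol: "solves_ray_eq (ball 0 \<eta>) 0 b L H A"
    and bound: "\<And>u. u \<in> ball 0 \<eta> \<Longrightarrow> norm (A u) \<le> K * norm u"
  shows "radial_solution \<eta> (quad_rhs b L H) A"
  unfolding radial_solution_def
proof (intro conjI allI impI ballI)
  interpret ray_eq "ball 0 \<eta>" b L H by fact
  show "continuous_on (ball 0 \<eta>) A" by (rule solves_ray_eqD(1)[OF sol])
  fix \<omega> :: 'a assume \<omega>: "norm \<omega> = 1"
  have "0 < \<eta>" using star_U by (simp add: star_at_0_def)
  moreover have "norm (A (r *\<^sub>R \<omega>)) \<le> K * r" if "r \<in> {0<..<\<eta>}" for r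
    using bound[of "r *\<^sub>R \<omega>"] \<omega> that by simp
  ultimately show "\<exists>K \<delta>. 0 < \<delta> \<and> (\<forall>r\<in>{0<..<\<delta>}. norm (A (r *\<^sub>R \<omega>)) \<le> K * r)" by blast
  fix r assume r: "r \<in> {0<..<\<eta>}"
  then obtain T where T: "r < T" "T < \<eta>" using dense by auto
  have "((\<lambda>s. s *\<^sub>R ray_avg 0 (rhs A) (s *\<^sub>R \<omega>)) has_vector_derivative rhs A (r *\<^sub>R \<omega>)) (at r)"
    by (rule ray_avg_radial_derivative[OF star_U continuous_on_rhs[OF solves_ray_eqD(1)[OF sol]] _ T(1)])
       (use r T \<omega> in auto)
  then show "((\<lambda>s. s *\<^sub>R A (s *\<^sub>R \<omega>)) has_vector_derivative rhs A (r *\<^sub>R \<omega>)) (at r)"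
    by (rule has_vector_derivative_transform_within_open[of _ _ _ "{0<..<T}"])
       (use r T \<omega> solves_ray_eqD(2)[OF sol] in auto)
qed

section \<open>The matrix equation\<close>

lemma norm_mat_le:
  fixes M :: "real^'n^'m"
  assumes "\<And>i j. \<bar>M $ i $ j\<bar> \<le> B"
  shows "norm M \<le> real CARD('m) * real CARD('n) * B"
proof -
  have "norm (M $ i) \<le> real CARD('n) * B" for i
    using order_trans[OF norm_le_l1_cart sum_bounded_above[of UNIV "\<lambda>j. \<bar>M $ i $ j\<bar>" B]] assms by simp
  then have "(\<Sum>i\<in>UNIV. norm (M $ i)) \<le> real CARD('m) * (real CARD('n) * B)"
    using sum_bounded_above[of UNIV "\<lambda>i. norm (M $ i)"] by simp
  moreover have "norm M \<le> (\<Sum>i\<in>UNIV. norm (M $ i))" unfolding norm_vec_def by (rule L2_set_le_sum) simp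
  ultimately show ?thesis by simp
qed

lemma opnorm_le_norm: "opnorm (M :: real^'k^'k) \<le> (real CARD('k))\<^sup>2 * norm M"
  unfolding opnorm_def power2_eq_square
  by (intro onorm_le_matrix_component order_trans[OF component_le_norm_cart]
      Finite_Cartesian_Product.norm_nth_le)

lemma norm_le_opnorm: "norm (M :: real^'k^'k) \<le> (real CARD('k))\<^sup>2 * opnorm M"
  unfolding opnorm_def power2_eq_square by (intro norm_mat_le matrix_component_le_onorm)

lemma bounded_bilinear_matrix_mult: "bounded_bilinear ((**) :: real^'k^'k \<Rightarrow> real^'k^'k \<Rightarrow> real^'k^'k)"
  unfolding bilinear_conv_bounded_bilinear[symmetric] bilinear_def
  by (auto intro!: linearI simp: matrix_matrix_mult_def vec_eq_iff sum.distrib sum_distrib_left algebra_simps)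

definition matmul :: "(real^'k^'k) \<Rightarrow>\<^sub>L (real^'k^'k) \<Rightarrow>\<^sub>L (real^'k^'k)" where
  "matmul = Blinfun (bounded_bilinear.prod_right (**))"

lemma matmul_apply: "matmul M N = M ** N"
  unfolding matmul_def
  by (simp add: bounded_linear_Blinfun_apply[OF bounded_bilinear.bounded_linear_prod_right]
      bounded_bilinear.prod_right.rep_eq bounded_bilinear_matrix_mult)

text \<open>The norm of \<open>real^'k^'k\<close> is the Frobenius norm.\<close>

lemma norm_matrix_mult_le:
  fixes M :: "real^'n^'m" and N :: "real^'l^'n"
  shows "norm (M ** N) \<le> norm M * norm N"
proof (rule power2_le_imp_le)
  have "(norm (M ** N))\<^sup>2 = (\<Sum>i\<in>UNIV. \<Sum>j\<in>UNIV. (M $ i \<bullet> column j N)\<^sup>2)"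
    unfolding power2_norm_eq_inner
    by (simp add: inner_vec_def matrix_matrix_mult_def column_def power2_eq_square)
  also have "\<dots> \<le> (\<Sum>i\<in>UNIV. \<Sum>j\<in>UNIV. (M $ i \<bullet> M $ i) * (column j N \<bullet> column j N))"
    by (intro sum_mono Cauchy_Schwarz_ineq)
  also have "\<dots> = (\<Sum>i\<in>UNIV. M $ i \<bullet> M $ i) * (\<Sum>j\<in>UNIV. column j N \<bullet> column j N)"
    by (simp add: sum_product)
  also have "(\<Sum>j\<in>UNIV. column j N \<bullet> column j N) = (norm N)\<^sup>2"
    unfolding power2_norm_eq_inner inner_vec_def column_def by (subst sum.swap) simp
  also have "(\<Sum>i\<in>UNIV. M $ i \<bullet> M $ i) = (norm M)\<^sup>2"
    by (simp add: power2_norm_eq_inner inner_vec_def[of M])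
  finally show "(norm (M ** N))\<^sup>2 \<le> (norm M * norm N)\<^sup>2" by (simp add: power_mult_distrib)
qed simp

lemma norm_matmul_apply_le: "norm (matmul M) \<le> norm M"
  by (rule norm_blinfun_bound) (simp_all add: matmul_apply norm_matrix_mult_le)

lemma norm_matmul_le: "norm (matmul :: (real^'k^'k) \<Rightarrow>\<^sub>L (real^'k^'k) \<Rightarrow>\<^sub>L (real^'k^'k)) \<le> 1"
  by (rule norm_blinfun_bound) (simp_all add: norm_matmul_apply_le)

definition riccati_rhs :: "('a \<Rightarrow> real^'k^'k) \<Rightarrow> ('a \<Rightarrow> real^'k^'k) \<Rightarrow> 'a \<Rightarrow> real^'k^'k" where
  "riccati_rhs C = quad_rhs (- matmul) (\<lambda>u. - matmul (C u)) (\<lambda>u. - C u)"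

lemma riccati_rhs_eq: "riccati_rhs C A u = - (A u ** A u) - C u ** A u - C u"
  by (simp add: riccati_rhs_def quad_rhs_def matmul_apply blinfun.minus_left)

lemma is_sol_iff_radial_solution:
  fixes A :: "real^'k \<Rightarrow> real^'k^'k"
  shows "is_sol \<eta> \<Omega> X x0 c A \<longleftrightarrow> radial_solution \<eta> (riccati_rhs (Cmat \<Omega> X x0 c)) A"
proof -
  have norm: "norm M \<le> ((real CARD('k))\<^sup>2 * K) * r" if "opnorm M \<le> K * r" for M :: "real^'k^'k" and K r
    using order_trans[OF norm_le_opnorm mult_left_mono[OF that]] by (simp add: mult.assoc)
  have opnorm: "opnorm M \<le> ((real CARD('k))\<^sup>2 * K) * r" if "norm M \<le> K * r" for M :: "real^'k^'k" and K r
    using order_trans[OF opnorm_le_norm mult_left_mono[OF that]] by (simp add: mult.assoc)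
  have "(\<exists>K \<delta>. \<delta> > 0 \<and> (\<forall>r\<in>{0<..<\<delta>}. opnorm (A (r *\<^sub>R \<omega>)) \<le> K * r)) \<longleftrightarrow>
        (\<exists>K \<delta>. \<delta> > 0 \<and> (\<forall>r\<in>{0<..<\<delta>}. norm (A (r *\<^sub>R \<omega>)) \<le> K * r))" for \<omega>
    using norm opnorm by meson
  then show ?thesis by (simp add: is_sol_def radial_solution_def riccati_rhs_eq)
qed

locale riccati =
  fixes \<eta> D :: real and C :: "real^'k \<Rightarrow> real^'k^'k"
  assumes \<eta>_pos: "0 < \<eta>" and D_nonneg: "0 \<le> D" and cont_C: "continuous_on (ball 0 \<eta>) C"
    and norm_C: "\<And>u. u \<in> ball 0 \<eta> \<Longrightarrow> norm (C u) \<le> D * norm u" and small: "10 * (D * \<eta>) \<le> 1"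

sublocale riccati \<subseteq> ray_eq "ball 0 \<eta>" "- matmul" "\<lambda>u. - matmul (C u)" "\<lambda>u. - C u"
  by unfold_locales (intro open_ball star_at_0_ball \<eta>_pos continuous_intros cont_C)+

context riccati
begin

lemma D\<eta>_nonneg: "0 \<le> D * \<eta>"
  using D_nonneg \<eta>_pos by simp

lemma norm_C_le: "u \<in> ball 0 \<eta> \<Longrightarrow> norm (- C u) \<le> D * \<eta>"
  using norm_C[of u] mult_left_mono[of "norm u" \<eta> D] D_nonneg by simp

lemma norm_matmul_C_le: "u \<in> ball 0 \<eta> \<Longrightarrow> norm (- matmul (C u)) \<le> D * \<eta>"
  using order_trans[OF norm_matmul_apply_le, of "C u"] norm_C_le by simp

lemma solution_exists:
  obtains A where "solves 0 A" "\<And>u. u \<in> ball 0 \<eta> \<Longrightarrow> norm (A u) \<le> 2 * D * norm u"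
proof -
  let ?\<mu> = "norm (- matmul :: (real^'k^'k) \<Rightarrow>\<^sub>L (real^'k^'k) \<Rightarrow>\<^sub>L (real^'k^'k))"
  have \<mu>: "?\<mu> * x \<le> x" if "0 \<le> x" for x using mult_right_mono[OF norm_matmul_le that] by simp
  obtain A where A: "solves 0 A" "\<And>u. u \<in> ball 0 \<eta> \<Longrightarrow> norm (A u) \<le> 2 * (D * \<eta>)"
  proof (rule solves_exists[OF norm_matmul_C_le norm_C_le])
    have \<mu>D\<eta>: "?\<mu> * (2 * (D * \<eta>)) \<le> 2 * (D * \<eta>)" using D\<eta>_nonneg by (intro \<mu>) simp
    then show "2 * ?\<mu> * (2 * (D * \<eta>)) + D * \<eta> < 1" using small by simp
    have "(?\<mu> * (2 * (D * \<eta>)) + D * \<eta>) * (2 * (D * \<eta>)) \<le> (1 / 2) * (2 * (D * \<eta>))"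
      using \<mu>D\<eta> small D\<eta>_nonneg by (intro mult_right_mono) auto
    then show "(?\<mu> * (2 * (D * \<eta>)) + D * \<eta>) * (2 * (D * \<eta>)) + D * \<eta> \<le> 2 * (D * \<eta>)" by simp
  qed (use D\<eta>_nonneg in auto)
  have "norm (A u) \<le> 2 * D * norm u" if u: "u \<in> ball 0 \<eta>" for u
  proof -
    have "norm (A u) \<le> (D * norm u) / (1 - 1 / 2)"
    proof (rule solves_norm_le[OF A(1) u])
      fix s :: real assume s: "s \<in> {0..1}"
      note su = star_at_0D[OF star_U u s]
      show "?\<mu> * norm (A (s *\<^sub>R u)) + norm (- matmul (C (s *\<^sub>R u))) \<le> 1 / 2"
        using \<mu>[OF norm_ge_zero, of "A (s *\<^sub>R u)"] A(2)[OF su] norm_matmul_C_le[OF su] small by linarith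
      have "norm (s *\<^sub>R u) \<le> norm u" using s by (simp add: mult_left_le_one_le)
      from order_trans[OF norm_C[OF su] mult_left_mono[OF this D_nonneg]]
      show "norm (- C (s *\<^sub>R u)) \<le> D * norm u" by simp
    qed simp
    then show ?thesis by simp
  qed
  then show thesis using that A(1) by blast
qed

lemma solution_Ck_bound:
  assumes sol: "solves 0 A" and A: "\<And>u. u \<in> ball 0 \<eta> \<Longrightarrow> norm (A u) \<le> 2 * D * norm u"
    and C: "Ck_bound m M C (ball 0 \<eta>)"
  shows "Ck_bound m (solution_Ck_const (1 / 2) m 1 M) A (ball 0 \<eta>)"
proof (rule solves_Ck_bound[OF ray_eq_axioms sol])
  show "norm (- matmul :: (real^'k^'k) \<Rightarrow>\<^sub>L (real^'k^'k) \<Rightarrow>\<^sub>L (real^'k^'k)) \<le> 1"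
    using norm_matmul_le by simp
  show "linearisation_norm_le (ball 0 \<eta>) (- matmul) (\<lambda>u. - matmul (C u)) A (1 / 2)"
    unfolding linearisation_norm_le_def
  proof (intro ballI)
    fix v w :: "real^'k" assume v: "v \<in> ball 0 \<eta>" and w: "w \<in> ball 0 \<eta>"
    have "norm (A v) \<le> 2 * (D * \<eta>)" using A[OF v] v mult_left_mono[of "norm v" \<eta> "2 * D"] D_nonneg by simp
    moreover have "norm (- matmul (C w)) \<le> D * \<eta>" by (rule norm_matmul_C_le[OF w])
    moreover have "norm (- matmul :: (real^'k^'k) \<Rightarrow>\<^sub>L (real^'k^'k) \<Rightarrow>\<^sub>L (real^'k^'k)) * norm (A v) \<le> norm (A v)"
      using mult_right_mono[OF norm_matmul_le norm_ge_zero] by simp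
    ultimately show "2 * norm (- matmul :: (real^'k^'k) \<Rightarrow>\<^sub>L (real^'k^'k) \<Rightarrow>\<^sub>L (real^'k^'k)) * norm (A v)
        + norm (- matmul (C w)) \<le> 1 / 2"
      using small by linarith
  qed
  have "Ck_bound m (1 * M) (\<lambda>u. - matmul (C u)) (ball 0 \<eta>)"
    by (rule Ck_bound_linear[where T = "\<lambda>M. - matmul M", OF _ _ _ C])
       (auto intro: bounded_linear_minus blinfun.bounded_linear_right norm_matmul_apply_le)
  then show "Ck_bound m M (\<lambda>u. - matmul (C u)) (ball 0 \<eta>)" by simp
  have "Ck_bound m (1 * M) (\<lambda>u. - C u) (ball 0 \<eta>)"
    by (rule Ck_bound_linear[where T = uminus, OF _ _ _ C])
       (auto intro: bounded_linear_minus bounded_linear_ident)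
  then show "Ck_bound m M (\<lambda>u. - C u) (ball 0 \<eta>)" by simp
qed simp

lemma radial_solution_well_posed:
  obtains A where "radial_solution \<eta> (riccati_rhs C) A" "solves 0 A"
    "\<And>u. u \<in> ball 0 \<eta> \<Longrightarrow> norm (A u) \<le> 2 * D * norm u"
    "\<And>A' u. radial_solution \<eta> (riccati_rhs C) A' \<Longrightarrow> u \<in> ball 0 \<eta> \<Longrightarrow> A' u = A u"
proof -
  obtain A where A: "solves 0 A" "\<And>u. u \<in> ball 0 \<eta> \<Longrightarrow> norm (A u) \<le> 2 * D * norm u"
    by (rule solution_exists) blast
  then have radial: "radial_solution \<eta> (riccati_rhs C) A"
    unfolding riccati_rhs_def by (rule solves_ray_eq_imp_radial_solution[OF ray_eq_axioms])
  have "A' u = A u" if "radial_solution \<eta> (riccati_rhs C) A'" "u \<in> ball 0 \<eta>" for A' u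
    using radial that(1) unfolding riccati_rhs_def
    by (rule radial_solution_unique[OF _ _ _ D_nonneg that(2)])
       (use norm_C in \<open>auto intro: order_trans[OF norm_matmul_apply_le]\<close>)
  then show thesis using that radial A by blast
qed

lemma radial_solution_Ck_bound:
  assumes A: "radial_solution \<eta> (riccati_rhs C) A" and C: "Ck_bound m M C (ball 0 \<eta>)"
  shows "Ck_bound m (solution_Ck_const (1 / 2) m 1 M) A (ball 0 \<eta>)"
proof -
  obtain A0 where A0: "solves 0 A0" "\<And>u. u \<in> ball 0 \<eta> \<Longrightarrow> norm (A0 u) \<le> 2 * D * norm u"
    and unique: "\<And>A' u. radial_solution \<eta> (riccati_rhs C) A' \<Longrightarrow> u \<in> ball 0 \<eta> \<Longrightarrow> A' u = A0 u"
    by (rule radial_solution_well_posed) blast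
  have "Ck_bound m (solution_Ck_const (1 / 2) m 1 M) A0 (ball 0 \<eta>)"
    by (rule solution_Ck_bound[OF A0 C])
  then show ?thesis by (rule Ck_bound_cong[OF open_ball]) (rule unique[OF A, symmetric])
qed

end

section \<open>Admissible constants\<close>

lemma setting_fields:
  assumes "setting \<Omega> X d \<xi> x0 c dmin dmax ximin CX Cc"
  shows "open \<Omega>" and "\<forall>j. C1_on \<Omega> (X j)" and "condC \<Omega> X d \<xi> x0"
  using assms unfolding setting_def C1_on_def by blast+

lemma setting_degrees:
  assumes "setting \<Omega> X d \<xi> x0 c dmin dmax ximin CX Cc"
  shows "dmin \<le> d j" and "d j \<le> dmax" and "ximin \<le> \<xi>" and "\<xi> \<le> 1"
  using assms unfolding setting_def by blast+

lemma setting_coefficients: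
  assumes "setting \<Omega> X d \<xi> x0 c dmin dmax ximin CX Cc"
  shows "continuous_on (ballXd \<Omega> X d \<xi> x0) (c i j k)"
    and "x \<in> ballXd \<Omega> X d \<xi> x0 \<Longrightarrow> \<bar>c i j k x\<bar> \<le> Cc"
  using assms unfolding setting_def Let_def by blast+

text \<open>The constant control with components \<open>u $ j / \<xi> powr d j\<close> steers along the flow of the constant
  combination \<open>u\<close>.\<close>

lemma integral_curve_in_ballXd:
  fixes X :: "'k::finite \<Rightarrow> real^'n \<Rightarrow> real^'n" and u :: "real^'k"
  assumes reachable: "condC \<Omega> X d \<xi> x0" and X: "\<forall>j. C1_on \<Omega> (X j)"
    and u: "norm u < R" and R: "\<And>j. R \<le> \<xi> powr d j" and \<xi>: "0 < \<xi>"
  obtains \<gamma> where "integral_curve (lincomb X u) \<Omega> x0 \<gamma>" "\<gamma> 1 \<in> ballXd \<Omega> X d \<xi> x0"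
proof -
  define a :: "real^'k" where "a = (\<chi> j. u $ j / \<xi> powr d j)"
  have a_scaled: "a $ j * \<xi> powr d j = u $ j" for j using \<xi> by (simp add: a_def)
  have R_pos: "0 < R" using u norm_ge_zero[of u] by linarith
  have "norm a \<le> norm ((1 / R) *\<^sub>R u)"
  proof (rule norm_le_componentwise_cart)
    fix j show "norm (a $ j) \<le> norm (((1 / R) *\<^sub>R u) $ j)"
      using R[of j] R_pos \<xi> by (simp add: a_def frac_le)
  qed
  also have "\<dots> < 1" using u R_pos by simp
  finally have adm: "adm_ctrl (\<lambda>t. a)" unfolding adm_ctrl_def by (auto intro!: exI[of _ "norm a"])
  then obtain \<gamma> where \<gamma>: "ctrl_path \<Omega> X d \<xi> x0 (\<lambda>t. a) \<gamma>" using reachable by (auto simp: condC_def)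
  show thesis
  proof (rule that)
    show "integral_curve (lincomb X u) \<Omega> x0 \<gamma>"
    proof (rule integral_curve_of_integral_equation)
      show "continuous_on \<Omega> (lincomb X u)"
        unfolding lincomb_def by (intro continuous_intros C1_onD(2)[OF spec[OF X]])
    qed (use \<gamma> in \<open>auto simp: ctrl_path_def lincomb_def a_scaled\<close>)
    show "\<gamma> 1 \<in> ballXd \<Omega> X d \<xi> x0" using \<gamma> adm by (auto simp: ballXd_def)
  qed
qed

lemma setting_integral_curve:
  fixes X :: "'k::finite \<Rightarrow> real^'n \<Rightarrow> real^'n" and u :: "real^'k"
  assumes setting: "setting \<Omega> X d \<xi> x0 c dmin dmax ximin CX Cc" and pos: "0 < dmin" "0 < ximin"
    and u: "u \<in> ball 0 (ximin powr dmax)"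
  obtains \<gamma> where "integral_curve (lincomb X u) \<Omega> x0 \<gamma>" "\<gamma> 1 \<in> ballXd \<Omega> X d \<xi> x0"
proof (rule integral_curve_in_ballXd[OF setting_fields(3,2)[OF setting]])
  note degrees = setting_degrees(1,2)[OF setting] and scale = setting_degrees(3,4)[OF setting]
  show "norm u < ximin powr dmax" using u by simp
  show "0 < \<xi>" using scale pos by simp
  show "ximin powr dmax \<le> \<xi> powr d j" for j
  proof -
    have "ximin powr dmax \<le> ximin powr d j" using degrees scale pos by (intro powr_mono') auto
    also have "\<dots> \<le> \<xi> powr d j" using order_trans[OF less_imp_le[OF pos(1)] degrees(1)] scale pos
      by (intro powr_mono2) auto
    finally show ?thesis .
  qed
qed (rule that)

lemma setting_ctilde:
  fixes X :: "'k::finite \<Rightarrow> real^'n \<Rightarrow> real^'n"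
  assumes setting: "setting \<Omega> X d \<xi> x0 c dmin dmax ximin CX Cc" and pos: "0 < dmin" "0 < ximin"
  shows "continuous_on (ball 0 (ximin powr dmax)) (ctilde \<Omega> X x0 c i j k)"
    and "u \<in> ball 0 (ximin powr dmax) \<Longrightarrow> \<bar>ctilde \<Omega> X x0 c i j k u\<bar> \<le> Cc"
proof -
  let ?V = "ball 0 (ximin powr dmax) :: (real^'k) set"
  note fields = setting_fields(2,1)[OF setting]
  have Phi: "Phi \<Omega> X x0 u \<in> ballXd \<Omega> X d \<xi> x0" if u: "u \<in> ?V" for u
    using setting_integral_curve[OF setting pos u] Phi_eq[OF fields] by metis
  have "continuous_on ?V (Phi \<Omega> X x0)"
    using setting_integral_curve[OF setting pos] by (intro continuous_on_Phi[OF fields]) blast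
  then show "continuous_on ?V (ctilde \<Omega> X x0 c i j k)"
    unfolding ctilde_def[abs_def] using Phi
    by (intro continuous_on_compose2[OF setting_coefficients(1)[OF setting]]) auto
  show "\<bar>ctilde \<Omega> X x0 c i j k u\<bar> \<le> Cc" if "u \<in> ?V"
    unfolding ctilde_def by (rule setting_coefficients(2)[OF setting Phi[OF that]])
qed

lemma norm_Cmat_le:
  fixes c :: "'k::finite \<Rightarrow> 'k \<Rightarrow> 'k \<Rightarrow> real^'n \<Rightarrow> real"
  assumes ctilde_le: "\<And>i j k. \<bar>ctilde \<Omega> X x0 c i j k u\<bar> \<le> M"
  shows "norm (Cmat \<Omega> X x0 c u) \<le> real CARD('k) ^ 3 * M * norm u"
proof -
  have "\<bar>Cmat \<Omega> X x0 c u $ i $ k\<bar> \<le> real CARD('k) * (norm u * M)" for i k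
  proof -
    have "\<bar>u $ j * ctilde \<Omega> X x0 c i j k u\<bar> \<le> norm u * M" for j
      unfolding abs_mult using component_le_norm_cart[of u j] ctilde_le[of i j k] by (intro mult_mono) auto
    then show ?thesis
      unfolding Cmat_def using sum_norm_le[of UNIV "\<lambda>j. u $ j * ctilde \<Omega> X x0 c i j k u" "\<lambda>j. norm u * M"]
      by simp
  qed
  from norm_mat_le[OF this] show ?thesis by (simp add: power3_eq_cube mult_ac)
qed

lemma Ck_bound_Cmat:
  fixes c :: "'k::finite \<Rightarrow> 'k \<Rightarrow> 'k \<Rightarrow> real^'n \<Rightarrow> real"
  assumes ctilde: "\<And>i j k. Ck_bound m M (ctilde \<Omega> X x0 c i j k) U"
    and U: "\<And>u. u \<in> U \<Longrightarrow> norm u \<le> R" and M: "0 \<le> M"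
  shows "Ck_bound m (real CARD('k) ^ 3 * (2 ^ m * (max R 1 * M))) (Cmat \<Omega> X x0 c) U"
proof -
  have component: "Ck_bound m (1 * max R 1) (\<lambda>u. u $ j) U" for j
    by (rule Ck_bound_linear[OF bounded_linear_vec_nth _ _ Ck_bound_ident[OF U]])
       (auto simp: component_le_norm_cart)
  have "Ck_bound m (\<Sum>j\<in>(UNIV::'k set). 2 ^ m * (1 * (1 * max R 1) * M)) (\<lambda>u. Cmat \<Omega> X x0 c u $ i $ k) U" for i k
    unfolding Cmat_def vec_lambda_beta
    by (intro Ck_bound_sum Ck_bound_bilinear[OF bounded_bilinear_mult] component ctilde)
       (auto simp: abs_mult M)
  from Ck_bound_vec[OF Ck_bound_vec[OF this]] show ?thesis by (simp add: power3_eq_cube mult_ac)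
qed

lemma setting_riccati:
  fixes X :: "'k::finite \<Rightarrow> real^'n \<Rightarrow> real^'n"
  assumes setting: "setting \<Omega> X d \<xi> x0 c dmin dmax ximin CX Cc" and pos: "0 < dmin" "0 < ximin"
    and \<eta>: "0 < \<eta>" "\<eta> \<le> ximin powr dmax" "10 * (real CARD('k) ^ 3 * \<bar>Cc\<bar> * \<eta>) \<le> 1"
  shows "riccati \<eta> (real CARD('k) ^ 3 * \<bar>Cc\<bar>) (Cmat \<Omega> X x0 c)"
proof (rule riccati.intro)
  note subset = subset_ball[OF \<eta>(2)]
  show "continuous_on (ball 0 \<eta>) (Cmat \<Omega> X x0 c)"
    unfolding Cmat_def[abs_def]
    by (intro continuous_intros continuous_on_subset[OF setting_ctilde(1)[OF setting pos] subset])
  show "norm (Cmat \<Omega> X x0 c u) \<le> real CARD('k) ^ 3 * \<bar>Cc\<bar> * norm u" if "u \<in> ball 0 \<eta>" for u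
    using setting_ctilde(2)[OF setting pos subsetD[OF subset that]]
    by (intro norm_Cmat_le) (rule order_trans[OF _ abs_ge_self])
qed (use \<eta> in auto)

lemma is_sol_well_posed:
  fixes X :: "'k::finite \<Rightarrow> real^'n \<Rightarrow> real^'n"
  assumes "riccati \<eta> D (Cmat \<Omega> X x0 c)" and \<kappa>: "2 * (real CARD('k))\<^sup>2 * D * \<eta> \<le> \<kappa>"
  shows "\<exists>A. is_sol \<eta> \<Omega> X x0 c A \<and>
    (\<forall>A'. is_sol \<eta> \<Omega> X x0 c A' \<longrightarrow> (\<forall>u\<in>ball 0 \<eta>. A' u = A u)) \<and>
    (\<forall>u\<in>ball 0 \<eta>. opnorm (A u) \<le> 2 * (real CARD('k))\<^sup>2 * D * norm u) \<and>
    (\<forall>u\<in>ball 0 \<eta>. opnorm (A u) \<le> \<kappa>)"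
proof -
  interpret riccati \<eta> D "Cmat \<Omega> X x0 c" by fact
  obtain A where A: "is_sol \<eta> \<Omega> X x0 c A" and bound: "\<And>u. u \<in> ball 0 \<eta> \<Longrightarrow> norm (A u) \<le> 2 * D * norm u"
    and unique: "\<And>A' u. is_sol \<eta> \<Omega> X x0 c A' \<Longrightarrow> u \<in> ball 0 \<eta> \<Longrightarrow> A' u = A u"
    unfolding is_sol_iff_radial_solution by (rule radial_solution_well_posed) blast
  have linear: "opnorm (A u) \<le> 2 * (real CARD('k))\<^sup>2 * D * norm u" if "u \<in> ball 0 \<eta>" for u
    using order_trans[OF opnorm_le_norm mult_left_mono[OF bound[OF that]]] by (simp add: mult_ac)
  have "opnorm (A u) \<le> \<kappa>" if u: "u \<in> ball 0 \<eta>" for u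
  proof -
    have "2 * (real CARD('k))\<^sup>2 * D * norm u \<le> 2 * (real CARD('k))\<^sup>2 * D * \<eta>"
      using u D_nonneg by (intro mult_left_mono) auto
    then show ?thesis using linear[OF u] \<kappa> by linarith
  qed
  then show ?thesis using A unique linear by blast
qed

lemma is_sol_regularity:
  fixes X :: "'k::finite \<Rightarrow> real^'n \<Rightarrow> real^'n"
  assumes "riccati \<eta> D (Cmat \<Omega> X x0 c)"
    and ctilde: "\<forall>i j k. is_Cm m (ctilde \<Omega> X x0 c i j k) (ball 0 \<eta>) \<and>
      Cm_norm_le m (ctilde \<Omega> X x0 c i j k) (ball 0 \<eta>) M"
    and A: "is_sol \<eta> \<Omega> X x0 c A"
  shows "(\<forall>i j. is_Cm m (\<lambda>u. A u $ i $ j) (ball 0 \<eta>)) \<and>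
    Cm_norm_le_mat m A (ball 0 \<eta>) (real (card {\<beta> :: 'k list. length \<beta> \<le> m}) * (real CARD('k))\<^sup>2 *
      solution_Ck_const (1 / 2) m 1 (real CARD('k) ^ 3 * (2 ^ m * (max \<eta> 1 * M))))"
proof -
  interpret riccati \<eta> D "Cmat \<Omega> X x0 c" by fact
  have ctilde_bound: "Ck_bound m M (ctilde \<Omega> X x0 c i j k) (ball 0 \<eta>)" for i j k
    using ctilde by (intro Cm_norm_le_imp_Ck_bound) blast+
  have "0 \<le> M" using order_trans[OF norm_ge_zero Ck_boundD(2)[OF ctilde_bound, of 0]] \<eta>_pos by simp
  then have "Ck_bound m (real CARD('k) ^ 3 * (2 ^ m * (max \<eta> 1 * M))) (Cmat \<Omega> X x0 c) (ball 0 \<eta>)"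
    by (intro Ck_bound_Cmat ctilde_bound) auto
  from radial_solution_Ck_bound[OF A[unfolded is_sol_iff_radial_solution] this]
  show ?thesis using Ck_bound_matrix_imp_Cm[OF open_ball] by blast
qed

lemma exists_small_radius:
  fixes R \<kappa> p q :: real
  assumes "0 < R" "0 < \<kappa>" "0 \<le> p" "0 \<le> q"
  obtains \<eta> where "0 < \<eta>" "\<eta> \<le> R" "p * \<eta> \<le> 1" "q * \<eta> \<le> \<kappa>"
proof
  define \<eta> where "\<eta> = min R (min (1 / (p + 1)) (\<kappa> / (q + 1)))"
  show "0 < \<eta>" "\<eta> \<le> R" using assms by (simp_all add: \<eta>_def)
  have "p * \<eta> \<le> p * (1 / (p + 1))" "q * \<eta> \<le> q * (\<kappa> / (q + 1))"
    using assms by (intro mult_left_mono; simp add: \<eta>_def)+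
  moreover have "p * (1 / (p + 1)) \<le> 1" "q * (\<kappa> / (q + 1)) \<le> \<kappa>"
    using assms by (simp_all add: pos_divide_le_eq algebra_simps)
  ultimately show "p * \<eta> \<le> 1" "q * \<eta> \<le> \<kappa>" by linarith+
qed

theorem theorem3p10:
  fixes \<kappa> dmin dmax ximin CX Cc :: real
  assumes "0 < \<kappa>" "\<kappa> \<le> 1/2" "0 < dmin" "0 < ximin"
  shows "\<exists>\<eta>1>0. \<exists>C.
    (\<forall>(\<Omega>::(real^'n) set) (X::'k::finite \<Rightarrow> real^'n \<Rightarrow> real^'n) d \<xi> x0 c.
       setting \<Omega> X d \<xi> x0 c dmin dmax ximin CX Cc \<longrightarrow>
       (\<exists>A. is_sol \<eta>1 \<Omega> X x0 c A \<and>
            (\<forall>A'. is_sol \<eta>1 \<Omega> X x0 c A' \<longrightarrow> (\<forall>u\<in>ball 0 \<eta>1. A' u = A u)) \<and>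
            (\<forall>u\<in>ball 0 \<eta>1. opnorm (A u) \<le> C * norm u) \<and>
            (\<forall>u\<in>ball 0 \<eta>1. opnorm (A u) \<le> \<kappa>))) \<and>
    (\<forall>(m::nat) Ct. \<exists>Cm.
      \<forall>(\<Omega>::(real^'n) set) (X::'k::finite \<Rightarrow> real^'n \<Rightarrow> real^'n) d \<xi> x0 c.
        setting \<Omega> X d \<xi> x0 c dmin dmax ximin CX Cc \<longrightarrow>
        (\<forall>i j k. is_Cm m (ctilde \<Omega> X x0 c i j k) (ball 0 \<eta>1) \<and>
                 Cm_norm_le m (ctilde \<Omega> X x0 c i j k) (ball 0 \<eta>1) Ct) \<longrightarrow>
        (\<forall>A. is_sol \<eta>1 \<Omega> X x0 c A \<longrightarrow>
             (\<forall>i j. is_Cm m (\<lambda>u. A u $ i $ j) (ball 0 \<eta>1)) \<and>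
             Cm_norm_le_mat m A (ball 0 \<eta>1) Cm))"
proof -
  define D where "D = real CARD('k) ^ 3 * \<bar>Cc\<bar>"
  have "0 < ximin powr dmax" "0 \<le> 10 * D" "0 \<le> 2 * (real CARD('k))\<^sup>2 * D"
    using assms by (simp_all add: D_def)
  then obtain \<eta> where \<eta>: "0 < \<eta>" "\<eta> \<le> ximin powr dmax" "10 * D * \<eta> \<le> 1" "2 * (real CARD('k))\<^sup>2 * D * \<eta> \<le> \<kappa>"
    using exists_small_radius[OF _ assms(1)] by metis
  have riccati: "riccati \<eta> D (Cmat \<Omega> X x0 c)" if "setting \<Omega> X d \<xi> x0 c dmin dmax ximin CX Cc"
    for \<Omega> :: "(real^'n) set" and X :: "'k \<Rightarrow> real^'n \<Rightarrow> real^'n" and d \<xi> x0 c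
    using setting_riccati[OF that assms(3,4) \<eta>(1,2)] \<eta>(3) by (simp add: D_def mult.assoc)
  note well_posed = is_sol_well_posed[OF riccati \<eta>(4)] and regularity = is_sol_regularity[OF riccati]
  show ?thesis
    by (rule exI[of _ \<eta>], rule conjI[OF \<eta>(1)], rule exI, intro conjI allI impI)
       (erule well_posed, rule exI, intro allI impI, erule (2) regularity)
qed

end
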